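(* Let $G$ be a finite group, $C=(\mathcal X,\mathcal K)$ a supercharacter theory of $G$, and $N\unlhd G$ a $C$-normal subgroup. If $G$ is $C$-almost monomial, then $G/N$ is $C^{G/N}$-almost monomial.
   Context: $\operatorname{Irr}(G)$ is the set of complex irreducible characters; $\lambda^G$ denotes induction. A supercharacter theory of $G$ is a pair $C=(\mathcal X,\mathcal K)$ with $\mathcal X$ a partition of $\operatorname{Irr}(G)$ and $\mathcal K$ a partition of $G$ such that $\{1\}\in\mathcal K$, $|\mathcal X|=|\mathcal K|$, and for each $X\in\mathcal X$ the character $\sigma_X=\sum_{\psi\in X}\psi(1)\psi$ is constant on each $K\in\mathcal K$. Given $C$ with $\mathcal X=\{X_1,\ldots,X_m\}$, $G$ is $C$-almost monomial if for any $k\neq\ell$ there exist subgroups $H_1,\ldots,H_t\leqslant G$ and linear characters $\lambda_i$ of $H_i$ with $\lambda_1^G+\cdots+\lambda_t^G=\sum_{i=1}^m\alpha_i\sigma_{X_i}$ for integers $\alpha_i\geq0$, $\alpha_k>0$, $\alpha_\ell=0$. A normal subgroup $N$ is $C$-normal if it is a union of members of $\mathcal K$. Identify $\operatorname{Irr}(G/N)$ with $\{\chi\in\operatorname{Irr}(G):N\subseteq\operatorname{Ker}\chi\}$ via $\widetilde\chi(gN)=\chi(g)$. When $N$ is $C$-normal, $\operatorname{Irr}(G/N)$ is a union of members of $\mathcal X$, and $C^{G/N}=(\widetilde{\mathcal X},\widetilde{\mathcal K})$ is the supercharacter theory of $G/N$ where $\widetilde{\mathcal X}$ consists of the sets $\widetilde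 X=\{\widetilde\chi:\chi\in X\}$ for those $X\in\mathcal X$ all of whose members contain $N$ in their kernel, and $\widetilde{\mathcal K}=\{KN/N:K\in\mathcal K\}$. *)

theory Defs
  imports
    "HOL-Algebra.Coset"
    "HOL-Library.Disjoint_Sets"
    "Jordan_Normal_Form.VS_Connect"
begin

section \<open>Complex characters of a group\<close>

text \<open>A representation of degree \<open>n\<close> is a homomorphism into $GL_n(\mathbf{C})$.\<close>

definition representation :: "('a, 'b) monoid_scheme \<Rightarrow> nat \<Rightarrow> ('a \<Rightarrow> complex mat) \<Rightarrow> bool" where
  "representation G n \<rho> \<longleftrightarrow> \<rho> \<in> hom G (units_of (ring_mat TYPE(complex) n ()))"

definition irreducible_representation ::
    "('a, 'b) monoid_scheme \<Rightarrow> nat \<Rightarrow> ('a \<Rightarrow> complex mat) \<Rightarrow> bool" where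
  "irreducible_representation G n \<rho> \<longleftrightarrow>
     representation G n \<rho> \<and> n > 0 \<and>
     (\<forall>W. VectorSpace.subspace class_ring W (module_vec TYPE(complex) n) \<and>
          (\<forall>g\<in>carrier G. \<forall>w\<in>W. \<rho> g *\<^sub>v w \<in> W)
          \<longrightarrow> W = {0\<^sub>v n} \<or> W = carrier_vec n)"

definition mat_trace :: "complex mat \<Rightarrow> complex" where
  "mat_trace A = (\<Sum>i<dim_row A. A $$ (i, i))"

text \<open>
  Characters are extensional on the carrier (\<open>undefined\<close> outside), so that distinct
  elements of \<open>Irr G\<close> are distinct as functions on the group.
\<close>

definition character_of :: "('a, 'b) monoid_scheme \<Rightarrow> ('a \<Rightarrow> complex mat) \<Rightarrow> 'a \<Rightarrow> complex" where
  "character_of G \<rho> = (\<lambda>g\<in>carrier G. mat_trace (\<rho> g))"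

definition Irr :: "('a, 'b) monoid_scheme \<Rightarrow> ('a \<Rightarrow> complex) set" where
  "Irr G = {character_of G \<rho> | n \<rho>. irreducible_representation G n \<rho>}"

definition linear_characters :: "('a, 'b) monoid_scheme \<Rightarrow> ('a \<Rightarrow> complex) set" where
  "linear_characters G = {character_of G \<rho> | \<rho>. representation G 1 \<rho>}"

definition char_kernel :: "('a, 'b) monoid_scheme \<Rightarrow> ('a \<Rightarrow> complex) \<Rightarrow> 'a set" where
  "char_kernel G \<chi> = {g \<in> carrier G. \<chi> g = \<chi> \<one>\<^bsub>G\<^esub>}"

text \<open>
  Induction from \<open>H\<close> to \<open>G\<close>:
  $\varphi^G(g) = \frac{1}{|H|} \sum_{x \in G} \varphi^\circ(x^{-1} g x)$, where
  $\varphi^\circ$ extends $\varphi$ by $0$ outside \<open>H\<close>.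
\<close>

definition induced_char ::
    "('a, 'b) monoid_scheme \<Rightarrow> 'a set \<Rightarrow> ('a \<Rightarrow> complex) \<Rightarrow> 'a \<Rightarrow> complex" where
  "induced_char G H \<phi> g =
     (\<Sum>x\<in>carrier G.
        let y = inv\<^bsub>G\<^esub> x \<otimes>\<^bsub>G\<^esub> g \<otimes>\<^bsub>G\<^esub> x in if y \<in> H then \<phi> y else 0) / of_nat (card H)"


section \<open>Supercharacter theories\<close>

type_synonym 'a sct = "('a \<Rightarrow> complex) set set \<times> 'a set set"

definition supercharacter ::
    "('a, 'b) monoid_scheme \<Rightarrow> ('a \<Rightarrow> complex) set \<Rightarrow> 'a \<Rightarrow> complex" where
  "supercharacter G X g = (\<Sum>\<psi>\<in>X. \<psi> \<one>\<^bsub>G\<^esub> * \<psi> g)"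

definition supercharacter_theory :: "('a, 'b) monoid_scheme \<Rightarrow> 'a sct \<Rightarrow> bool" where
  "supercharacter_theory G C \<longleftrightarrow>
     (case C of (\<X>, \<K>) \<Rightarrow>
        partition_on (Irr G) \<X> \<and> partition_on (carrier G) \<K> \<and>
        {\<one>\<^bsub>G\<^esub>} \<in> \<K> \<and> card \<X> = card \<K> \<and>
        (\<forall>X\<in>\<X>. \<forall>K\<in>\<K>. \<forall>g\<in>K. \<forall>h\<in>K. supercharacter G X g = supercharacter G X h))"

text \<open>
  In \<open>almost_monomial\<close> the coefficients $\alpha_i$ are indexed by the members of $\mathcal{X}$
  themselves.
\<close>

definition almost_monomial :: "('a, 'b) monoid_scheme \<Rightarrow> 'a sct \<Rightarrow> bool" where
  "almost_monomial G C \<longleftrightarrow>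
     (case C of (\<X>, \<K>) \<Rightarrow>
        \<forall>Y\<in>\<X>. \<forall>Z\<in>\<X>. Y \<noteq> Z \<longrightarrow>
          (\<exists>(t::nat) (H :: nat \<Rightarrow> 'a set) (\<mu> :: nat \<Rightarrow> 'a \<Rightarrow> complex)
             (\<alpha> :: ('a \<Rightarrow> complex) set \<Rightarrow> nat).
             (\<forall>i\<in>{1..t}. subgroup (H i) G \<and>
                          \<mu> i \<in> linear_characters (G\<lparr>carrier := H i\<rparr>)) \<and>
             (\<forall>g\<in>carrier G.
                (\<Sum>i\<in>{1..t}. induced_char G (H i) (\<mu> i) g) =
                (\<Sum>X\<in>\<X>. of_nat (\<alpha> X) * supercharacter G X g)) \<and>
             \<alpha> Y > 0 \<and> \<alpha> Z = 0))"

definition C_normal :: "('a, 'b) monoid_scheme \<Rightarrow> 'a sct \<Rightarrow> 'a set \<Rightarrow> bool" where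
  "C_normal G C N \<longleftrightarrow> N \<lhd> G \<and> (\<exists>\<A>. \<A> \<subseteq> snd C \<and> N = \<Union>\<A>)"


section \<open>The quotient theory\<close>

text \<open>
  \<open>quotient_char G N \<chi>\<close> is $\widetilde\chi(gN) = \chi(g)$; it is only meaningful when \<open>N\<close> is
  contained in the kernel of \<open>\<chi>\<close>, for then \<open>\<chi>\<close> takes a single value on each coset.
\<close>

definition quotient_char ::
    "('a, 'b) monoid_scheme \<Rightarrow> 'a set \<Rightarrow> ('a \<Rightarrow> complex) \<Rightarrow> 'a set \<Rightarrow> complex" where
  "quotient_char G N \<chi> = (\<lambda>A\<in>carrier (G Mod N). the_elem (\<chi> ` A))"

definition quotient_sct :: "('a, 'b) monoid_scheme \<Rightarrow> 'a set \<Rightarrow> 'a sct \<Rightarrow> 'a set sct" where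
  "quotient_sct G N C =
     (case C of (\<X>, \<K>) \<Rightarrow>
        ({quotient_char G N ` X | X. X \<in> \<X> \<and> (\<forall>\<chi>\<in>X. N \<subseteq> char_kernel G \<chi>)},
         {(\<lambda>k. N #>\<^bsub>G\<^esub> k) ` K | K. K \<in> \<K>}))"

end

theory Submission
  imports Defs "Jordan_Normal_Form.Spectral_Radius" "HOL-Library.Function_Algebras"
begin

text \<open>
  Sum both sides of an almost-monomiality identity for \<open>G\<close> over the cosets of \<open>N\<close>. By Schur's lemma
  \<open>\<Sum>\<^bsub>n \<in> N\<^esub> \<rho>(n)\<close> is a scalar for an irreducible \<open>\<rho>\<close>, and it vanishes unless \<open>N\<close> acts trivially;
  so the coset sums of an irreducible character vanish unless \<open>N\<close> is in its kernel, in which case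
  they are \<open>|N|\<close> times the character of the quotient. Likewise the coset sums of \<open>\<lambda>\<^sup>G\<close> with \<open>\<lambda>\<close> a
  linear character of \<open>H\<close> vanish if \<open>\<lambda>\<close> is nontrivial on \<open>N \<inter> H\<close>, and otherwise they are \<open>|N|\<close>
  times the character induced from the linear character of \<open>HN/N\<close> through which \<open>\<lambda>\<close> factors.
  No block of the supercharacter theory is cut into two by this, because the indicator function
  of the \<open>C\<close>-normal subgroup \<open>N\<close> is a combination of the supercharacters.
\<close>

section \<open>Matrix sums and Schur's lemma\<close>

text \<open>Matrices of all sizes share one type, so the dimensions are explicit parameters; the
  empty sum is then the zero matrix of the intended shape.\<close>

definition mat_sum :: "nat \<Rightarrow> nat \<Rightarrow> 'a set \<Rightarrow> ('a \<Rightarrow> complex mat) \<Rightarrow> complex mat" where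
  "mat_sum n m S f = mat n m (\<lambda>ij. \<Sum>g\<in>S. f g $$ ij)"

lemma mat_sum_carrier [simp]: "mat_sum n m S f \<in> carrier_mat n m"
  by (simp add: mat_sum_def)

lemma mat_sum_cong: "(\<And>g. g \<in> S \<Longrightarrow> f g = h g) \<Longrightarrow> mat_sum n m S f = mat_sum n m S h"
  by (simp add: mat_sum_def cong: sum.cong)

lemma mult_mat_sum:
  assumes "B \<in> carrier_mat k n" and "\<And>g. g \<in> S \<Longrightarrow> f g \<in> carrier_mat n m"
  shows "B * mat_sum n m S f = mat_sum k m S (\<lambda>g. B * f g)"
proof (rule eq_matI)
  fix i j
  assume "i < dim_row (mat_sum k m S (\<lambda>g. B * f g))" "j < dim_col (mat_sum k m S (\<lambda>g. B * f g))"
  then have ij: "i < k" "j < m" by (simp_all add: mat_sum_def)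
  have "(B * mat_sum n m S f) $$ (i, j) = (\<Sum>l<n. B $$ (i, l) * (\<Sum>g\<in>S. f g $$ (l, j)))"
    using assms(1) ij by (auto simp: mat_sum_def scalar_prod_def atLeast0LessThan intro!: sum.cong)
  also have "\<dots> = (\<Sum>g\<in>S. \<Sum>l<n. B $$ (i, l) * f g $$ (l, j))"
    by (simp add: sum_distrib_left sum.swap[of _ S])
  also have "\<dots> = (\<Sum>g\<in>S. (B * f g) $$ (i, j))"
  proof (rule sum.cong[OF refl])
    fix g assume "g \<in> S"
    with assms(2) have "f g \<in> carrier_mat n m" by blast
    then show "(\<Sum>l<n. B $$ (i, l) * f g $$ (l, j)) = (B * f g) $$ (i, j)"
      using assms(1) ij by (auto simp: scalar_prod_def atLeast0LessThan intro!: sum.cong)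
  qed
  finally show "(B * mat_sum n m S f) $$ (i, j) = mat_sum k m S (\<lambda>g. B * f g) $$ (i, j)"
    using ij by (simp add: mat_sum_def)
qed (use assms(1) in \<open>auto simp: mat_sum_def\<close>)

lemma mat_sum_mult:
  assumes "B \<in> carrier_mat m k" and "\<And>g. g \<in> S \<Longrightarrow> f g \<in> carrier_mat n m"
  shows "mat_sum n m S f * B = mat_sum n k S (\<lambda>g. f g * B)"
proof (rule eq_matI)
  fix i j
  assume "i < dim_row (mat_sum n k S (\<lambda>g. f g * B))" "j < dim_col (mat_sum n k S (\<lambda>g. f g * B))"
  then have ij: "i < n" "j < k" by (simp_all add: mat_sum_def)
  have "(mat_sum n m S f * B) $$ (i, j) = (\<Sum>l<m. (\<Sum>g\<in>S. f g $$ (i, l)) * B $$ (l, j))"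
    using assms(1) ij by (auto simp: mat_sum_def scalar_prod_def atLeast0LessThan intro!: sum.cong)
  also have "\<dots> = (\<Sum>g\<in>S. \<Sum>l<m. f g $$ (i, l) * B $$ (l, j))"
    by (simp add: sum_distrib_right sum.swap[of _ S])
  also have "\<dots> = (\<Sum>g\<in>S. (f g * B) $$ (i, j))"
  proof (rule sum.cong[OF refl])
    fix g assume "g \<in> S"
    with assms(2) have "f g \<in> carrier_mat n m" by blast
    then show "(\<Sum>l<m. f g $$ (i, l) * B $$ (l, j)) = (f g * B) $$ (i, j)"
      using assms(1) ij by (auto simp: scalar_prod_def atLeast0LessThan intro!: sum.cong)
  qed
  finally show "(mat_sum n m S f * B) $$ (i, j) = mat_sum n k S (\<lambda>g. f g * B) $$ (i, j)"
    using ij by (simp add: mat_sum_def)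
qed (use assms(1) in \<open>auto simp: mat_sum_def\<close>)

lemma mat_sum_reindex:
  "bij_betw p T S \<Longrightarrow> mat_sum n m S f = mat_sum n m T (\<lambda>g. f (p g))"
  unfolding mat_sum_def by (subst sum.reindex_bij_betw[symmetric, of p T S]) simp_all

lemma mat_trace_mult_comm:
  assumes "A \<in> carrier_mat n m" "B \<in> carrier_mat m n"
  shows "mat_trace (A * B) = mat_trace (B * A)"
proof -
  have "mat_trace (A * B) = (\<Sum>i<n. \<Sum>j<m. A $$ (i, j) * B $$ (j, i))"
    using assms by (auto simp: mat_trace_def scalar_prod_def atLeast0LessThan intro!: sum.cong)
  also have "\<dots> = (\<Sum>j<m. \<Sum>i<n. B $$ (j, i) * A $$ (i, j))"
    by (subst sum.swap) (simp add: mult.commute)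
  also have "\<dots> = mat_trace (B * A)"
    using assms by (auto simp: mat_trace_def scalar_prod_def atLeast0LessThan intro!: sum.cong)
  finally show ?thesis .
qed

lemma mat_trace_smult_one: "mat_trace (c \<cdot>\<^sub>m 1\<^sub>m n) = c * of_nat n"
  by (simp add: mat_trace_def)

lemma mat_trace_mat_sum:
  assumes "\<And>g. g \<in> S \<Longrightarrow> f g \<in> carrier_mat n n"
  shows "mat_trace (mat_sum n n S f) = (\<Sum>g\<in>S. mat_trace (f g))"
proof -
  have "mat_trace (mat_sum n n S f) = (\<Sum>g\<in>S. \<Sum>i<n. f g $$ (i, i))"
    by (simp add: mat_trace_def mat_sum_def) (rule sum.swap)
  also have "\<dots> = (\<Sum>g\<in>S. mat_trace (f g))"
    using assms by (auto simp: mat_trace_def intro!: sum.cong)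
  finally show ?thesis .
qed

lemma mat_index_eq_mult_unit_vec:
  fixes A :: "complex mat"
  assumes "A \<in> carrier_mat n m" "i < n" "j < m"
  shows "A $$ (i, j) = (A *\<^sub>v unit_vec m j) $ i"
  using assms scalar_prod_right_unit[of j m "row A i"] by auto

text \<open>Reduces the abstract notion of subspace in the definition of irreducibility to closure
  conditions that can be checked on concrete sets of vectors.\<close>

lemma module_vec_subspaceI:
  fixes W :: "complex vec set"
  assumes "W \<subseteq> carrier_vec n" "0\<^sub>v n \<in> W"
    and "\<And>v w. v \<in> W \<Longrightarrow> w \<in> W \<Longrightarrow> v + w \<in> W"
    and "\<And>c v. v \<in> W \<Longrightarrow> c \<cdot>\<^sub>v v \<in> W"
  shows "VectorSpace.subspace class_ring W (module_vec TYPE(complex) n)"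
  unfolding VectorSpace.subspace_def submodule_def
  by (intro conjI vec_vs vec_module) (use assms in \<open>simp_all add: module_vec_simps\<close>)

section \<open>Matrix representations and Schur's lemma\<close>

context group
begin

lemma representation_carrier:
  assumes "representation G n \<rho>" "g \<in> carrier G"
  shows "\<rho> g \<in> carrier_mat n n"
  using assms by (auto simp: representation_def hom_def units_of_def Units_def ring_mat_def)

lemma representation_mult:
  assumes "representation G n \<rho>" "g \<in> carrier G" "h \<in> carrier G"
  shows "\<rho> (g \<otimes> h) = \<rho> g * \<rho> h"
  using assms by (auto simp: representation_def hom_def units_of_def ring_mat_def)

lemma representation_one:
  assumes "representation G n \<rho>"
  shows "\<rho> \<one> = 1\<^sub>m n"
proof -
  interpret R: ring "ring_mat TYPE(complex) n ()" by (rule ring_mat)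
  have "group_hom G (units_of (ring_mat TYPE(complex) n ())) \<rho>"
    using assms R.units_group by (simp add: group_hom_def group_hom_axioms_def representation_def)
  from group_hom.hom_one[OF this] show ?thesis
    by (simp add: units_of_def ring_mat_def)
qed

lemma representation_inv:
  assumes "representation G n \<rho>" "g \<in> carrier G"
  shows "\<rho> (inv g) * \<rho> g = 1\<^sub>m n" "\<rho> g * \<rho> (inv g) = 1\<^sub>m n"
  using representation_one[OF assms(1)] assms(2)
  by (simp_all flip: representation_mult[OF assms(1)])

lemma irreducible_invariant:
  assumes "irreducible_representation G n \<rho>"
    and "W \<subseteq> carrier_vec n" "0\<^sub>v n \<in> W"
    and "\<And>v w. v \<in> W \<Longrightarrow> w \<in> W \<Longrightarrow> v + w \<in> W"
    and "\<And>c v. v \<in> W \<Longrightarrow> c \<cdot>\<^sub>v v \<in> W"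
    and "\<And>g w. g \<in> carrier G \<Longrightarrow> w \<in> W \<Longrightarrow> \<rho> g *\<^sub>v w \<in> W"
  shows "W = {0\<^sub>v n} \<or> W = carrier_vec n"
proof -
  have "VectorSpace.subspace class_ring W (module_vec TYPE(complex) n)"
    by (rule module_vec_subspaceI[OF assms(2-5)])
  moreover have "\<forall>g\<in>carrier G. \<forall>w\<in>W. \<rho> g *\<^sub>v w \<in> W"
    using assms(6) by simp
  ultimately show ?thesis
    using assms(1) unfolding irreducible_representation_def by simp
qed

text \<open>The kernel of an intertwiner is an invariant subspace of the domain. Since the domain is
  irreducible, a single nonzero kernel vector makes the kernel the whole space. Irreducibility is
  asked of the domain only, so both forms of Schur's lemma below can use this.\<close>

lemma intertwiner_kernel:
  assumes \<rho>': "irreducible_representation G m \<rho>'" and \<rho>: "representation G n \<rho>"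
    and T: "T \<in> carrier_mat n m"
    and comm: "\<And>g. g \<in> carrier G \<Longrightarrow> \<rho> g * T = T * \<rho>' g"
    and v: "v \<in> carrier_vec m" "v \<noteq> 0\<^sub>v m" "T *\<^sub>v v = 0\<^sub>v n"
  shows "T = 0\<^sub>m n m"
proof -
  have r: "representation G m \<rho>'" using \<rho>' by (simp add: irreducible_representation_def)
  define W where "W = {w \<in> carrier_vec m. T *\<^sub>v w = 0\<^sub>v n}"
  have "W = {0\<^sub>v m} \<or> W = carrier_vec m"
  proof (rule irreducible_invariant[OF \<rho>'])
    fix g w assume g: "g \<in> carrier G" and w: "w \<in> W"
    have "T *\<^sub>v (\<rho>' g *\<^sub>v w) = (T * \<rho>' g) *\<^sub>v w"
      using w T representation_carrier[OF r g] by (simp add: W_def)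
    also have "\<dots> = \<rho> g *\<^sub>v (T *\<^sub>v w)"
      using w T representation_carrier[OF \<rho> g] by (simp add: W_def flip: comm[OF g])
    also have "\<dots> = 0\<^sub>v n"
      using w representation_carrier[OF \<rho> g] by (auto simp: W_def)
    finally show "\<rho>' g *\<^sub>v w \<in> W"
      using w representation_carrier[OF r g] by (auto simp: W_def)
  qed (use T in \<open>auto simp: W_def mult_add_distrib_mat_vec mult_mat_vec\<close>)
  with v have "W = carrier_vec m" by (auto simp: W_def)
  then have z: "T *\<^sub>v w = 0\<^sub>v n" if "w \<in> carrier_vec m" for w
    using that by (auto simp: W_def)
  show ?thesis
  proof (rule eq_matI)
    fix i j assume "i < dim_row (0\<^sub>m n m :: complex mat)" "j < dim_col (0\<^sub>m n m :: complex mat)"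
    then have ij: "i < n" "j < m" by auto
    have "T $$ (i, j) = (T *\<^sub>v unit_vec m j) $ i"
      by (rule mat_index_eq_mult_unit_vec[OF T ij])
    then show "T $$ (i, j) = 0\<^sub>m n m $$ (i, j)"
      using z[of "unit_vec m j"] ij by simp
  qed (use T in auto)
qed

text \<open>The kernel of \<open>T\<close> is trivial by the previous lemma. The range is invariant
  and nonzero, hence everything, by irreducibility of the target. So \<open>T\<close> is bijective,
  and its inverse is written down as a matrix.\<close>

lemma schur_isomorphism:
  assumes \<rho>: "irreducible_representation G n \<rho>" and \<rho>': "irreducible_representation G m \<rho>'"
    and T: "T \<in> carrier_mat n m" "T \<noteq> 0\<^sub>m n m"
    and comm: "\<And>g. g \<in> carrier G \<Longrightarrow> \<rho> g * T = T * \<rho>' g"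
  shows "\<exists>S \<in> carrier_mat m n. T * S = 1\<^sub>m n \<and> S * T = 1\<^sub>m m"
proof -
  have r: "representation G n \<rho>" and r': "representation G m \<rho>'"
    using \<rho> \<rho>' by (simp_all add: irreducible_representation_def)
  define W where "W = (\<lambda>v. T *\<^sub>v v) ` carrier_vec m"
  have ker: "v = 0\<^sub>v m" if "v \<in> carrier_vec m" "T *\<^sub>v v = 0\<^sub>v n" for v
    using intertwiner_kernel[OF \<rho>' r T(1) comm that(1) _ that(2)] T(2) by blast
  have W: "W = {0\<^sub>v n} \<or> W = carrier_vec n"
  proof (rule irreducible_invariant[OF \<rho>])
    show "W \<subseteq> carrier_vec n" using T by (auto simp: W_def)
    have "T *\<^sub>v 0\<^sub>v m = 0\<^sub>v n" using T by auto
    then show "0\<^sub>v n \<in> W" unfolding W_def by (metis image_eqI zero_carrier_vec)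
  next
    fix v w assume "v \<in> W" "w \<in> W"
    then obtain a b where "a \<in> carrier_vec m" "b \<in> carrier_vec m" "v = T *\<^sub>v a" "w = T *\<^sub>v b"
      by (auto simp: W_def)
    then show "v + w \<in> W" unfolding W_def
      using mult_add_distrib_mat_vec[OF T(1), of a b] by (metis add_carrier_vec image_eqI)
  next
    fix c v assume "v \<in> W"
    then obtain a where "a \<in> carrier_vec m" "v = T *\<^sub>v a"
      by (auto simp: W_def)
    then show "c \<cdot>\<^sub>v v \<in> W" unfolding W_def
      using mult_mat_vec[OF T(1), of a c] by (metis smult_carrier_vec image_eqI)
  next
    fix g w assume g: "g \<in> carrier G" and "w \<in> W"
    then obtain a where a: "a \<in> carrier_vec m" "w = T *\<^sub>v a"
      by (auto simp: W_def)
    have "\<rho> g *\<^sub>v w = (\<rho> g * T) *\<^sub>v a"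
      using a T representation_carrier[OF r g] by simp
    also have "\<dots> = T *\<^sub>v (\<rho>' g *\<^sub>v a)"
      using a T representation_carrier[OF r' g] by (simp add: comm[OF g])
    finally show "\<rho> g *\<^sub>v w \<in> W"
      using a representation_carrier[OF r' g] by (auto simp: W_def)
  qed
  have "W \<noteq> {0\<^sub>v n}"
  proof
    assume "W = {0\<^sub>v n}"
    then have z: "T *\<^sub>v v = 0\<^sub>v n" if "v \<in> carrier_vec m" for v
      using that by (auto simp: W_def)
    have "m > 0" using \<rho>' by (simp add: irreducible_representation_def)
    then have "unit_vec m 0 \<noteq> (0\<^sub>v m :: complex vec)"
      by (metis index_unit_vec(2) index_zero_vec(1) zero_neq_one)
    with ker[of "unit_vec m 0"] z[of "unit_vec m 0"] show False by simp
  qed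
  with W have "W = carrier_vec n" by blast
  then have "\<exists>v. v \<in> carrier_vec m \<and> T *\<^sub>v v = unit_vec n i" for i
    by (metis (no_types, lifting) W_def imageE unit_vec_carrier)
  then obtain s where s: "\<And>i. s i \<in> carrier_vec m" "\<And>i. T *\<^sub>v s i = unit_vec n i"
    by metis
  \<comment> \<open>The columns of \<open>S\<close> are preimages of the unit vectors under
    \<open>T\<close>, which makes \<open>S\<close> a right inverse.\<close>
  define S where "S = mat m n (\<lambda>(i, j). s j $ i)"
  have S: "S \<in> carrier_mat m n" by (simp add: S_def)
  have col: "col S j = s j" if "j < n" for j
    using that s(1)[of j] by (auto simp: S_def)
  have TS: "T * S = 1\<^sub>m n"
  proof (rule eq_matI)
    fix i j assume "i < dim_row (1\<^sub>m n :: complex mat)" "j < dim_col (1\<^sub>m n :: complex mat)"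
    then have ij: "i < n" "j < n" by auto
    have "(T * S) $$ (i, j) = (T *\<^sub>v s j) $ i" using ij T S col by simp
    then show "(T * S) $$ (i, j) = 1\<^sub>m n $$ (i, j)" using ij by (simp add: s(2))
  qed (use T S in auto)
  \<comment> \<open>For the left inverse no comparison of \<open>n\<close> with \<open>m\<close> is
    made: \<open>T\<close> kills \<open>S T e - e\<close> for every unit vector \<open>e\<close>,
    because \<open>T * S = 1\<close>, and \<open>T\<close> is injective.\<close>
  have "S * T = 1\<^sub>m m"
  proof (rule eq_matI)
    fix i j assume "i < dim_row (1\<^sub>m m :: complex mat)" "j < dim_col (1\<^sub>m m :: complex mat)"
    then have ij: "i < m" "j < m" by auto
    let ?v = "S *\<^sub>v (T *\<^sub>v unit_vec m j) - unit_vec m j"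
    have "T *\<^sub>v ?v = T *\<^sub>v (S *\<^sub>v (T *\<^sub>v unit_vec m j)) - T *\<^sub>v unit_vec m j"
      using T S by (intro mult_minus_distrib_mat_vec[of _ n m]) auto
    also have "T *\<^sub>v (S *\<^sub>v (T *\<^sub>v unit_vec m j)) = (T * S) *\<^sub>v (T *\<^sub>v unit_vec m j)"
      using T S by (intro assoc_mult_mat_vec[symmetric, of _ n m _ n]) auto
    also have "\<dots> - T *\<^sub>v unit_vec m j = 0\<^sub>v n"
      using T by (simp add: TS)
    finally have "?v = 0\<^sub>v m" using S T by (intro ker) auto
    moreover have "(S * T) $$ (i, j) = (S *\<^sub>v (T *\<^sub>v unit_vec m j)) $ i"
    proof -
      have "S *\<^sub>v (T *\<^sub>v unit_vec m j) = (S * T) *\<^sub>v unit_vec m j"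
        using T S by (intro assoc_mult_mat_vec[symmetric, of _ m n _ m]) auto
      then show ?thesis using mat_index_eq_mult_unit_vec[of "S * T" m m i j] ij S T by simp
    qed
    moreover have "?v $ i = (S *\<^sub>v (T *\<^sub>v unit_vec m j)) $ i - unit_vec m j $ i"
      using ij S by (intro index_minus_vec) auto
    ultimately show "(S * T) $$ (i, j) = 1\<^sub>m m $$ (i, j)"
      using ij by simp
  qed (use T S in auto)
  with TS S show ?thesis by blast
qed

text \<open>Over the complex numbers \<open>T\<close> has an eigenvalue \<open>c\<close>. Then
  \<open>T - c\<close> is an intertwiner with a nonzero kernel vector, so it vanishes.\<close>

lemma schur_scalar:
  assumes \<rho>: "irreducible_representation G n \<rho>"
    and T: "T \<in> carrier_mat n n"
    and comm: "\<And>g. g \<in> carrier G \<Longrightarrow> \<rho> g * T = T * \<rho> g"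
  shows "\<exists>c. T = c \<cdot>\<^sub>m 1\<^sub>m n"
proof -
  have r: "representation G n \<rho>" and n: "n > 0"
    using \<rho> by (simp_all add: irreducible_representation_def)
  obtain c where "eigenvalue T c"
    using spectrum_non_empty[OF T n] by (auto simp: spectrum_def)
  then obtain v where v: "v \<in> carrier_vec n" "v \<noteq> 0\<^sub>v n" "T *\<^sub>v v = c \<cdot>\<^sub>v v"
    using T by (auto simp: eigenvalue_def eigenvector_def)
  have "T - c \<cdot>\<^sub>m 1\<^sub>m n = 0\<^sub>m n n"
  proof (rule intertwiner_kernel[OF \<rho> r _ _ v(1,2)])
    show "(T - c \<cdot>\<^sub>m 1\<^sub>m n) *\<^sub>v v = 0\<^sub>v n"
      using T v by (auto simp: minus_mult_distrib_mat_vec)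
    show "\<rho> g * (T - c \<cdot>\<^sub>m 1\<^sub>m n) = (T - c \<cdot>\<^sub>m 1\<^sub>m n) * \<rho> g" if g: "g \<in> carrier G" for g
    proof -
      note [simp] = representation_carrier[OF r g]
      have "\<rho> g * (T - c \<cdot>\<^sub>m 1\<^sub>m n) = \<rho> g * T - \<rho> g * (c \<cdot>\<^sub>m 1\<^sub>m n)"
        using T by (intro mult_minus_distrib_mat[of _ n n _ n]) auto
      also have "\<rho> g * (c \<cdot>\<^sub>m 1\<^sub>m n) = c \<cdot>\<^sub>m (\<rho> g * 1\<^sub>m n)"
        by (rule mult_smult_distrib[of _ n n _ n]) auto
      also have "\<dots> = (c \<cdot>\<^sub>m 1\<^sub>m n) * \<rho> g"
        by (simp add: mult_smult_assoc_mat[of _ n n _ n] left_mult_one_mat[of _ n n] right_mult_one_mat[of _ n n])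
      also have "\<rho> g * T - (c \<cdot>\<^sub>m 1\<^sub>m n) * \<rho> g = (T - c \<cdot>\<^sub>m 1\<^sub>m n) * \<rho> g"
        using T by (simp add: comm[OF g] minus_mult_distrib_mat[of _ n n _ _ n])
      finally show ?thesis .
    qed
  qed (use T in auto)
  moreover have "T = (T - c \<cdot>\<^sub>m 1\<^sub>m n) + c \<cdot>\<^sub>m 1\<^sub>m n" using T by auto
  ultimately show ?thesis using T by auto
qed

end

section \<open>Orthogonality and sums over normal subgroups\<close>

text \<open>Taken at \<open>k = i\<close> and \<open>l = j\<close>, this turns a product of two
  diagonal entries, as it occurs in a product of traces, into one entry of a matrix that can be
  averaged over the group.\<close>

lemma mult_matrix_unit_mult:
  fixes B D :: "complex mat"
  assumes B: "B \<in> carrier_mat n n" and D: "D \<in> carrier_mat m m" and ij: "i < n" "j < m" and kl: "k < n" "l < m"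
  shows "(B * mat n m (\<lambda>p. if p = (k, l) then 1 else 0) * D) $$ (i, j) = B $$ (i, k) * D $$ (l, j)"
proof -
  have BE: "(B * mat n m (\<lambda>p. if p = (k, l) then 1 else 0)) $$ (i, q) = (if q = l then B $$ (i, k) else 0)"
    if "q < m" for q
  proof -
    have "(B * mat n m (\<lambda>p. if p = (k, l) then 1 else 0)) $$ (i, q)
        = (\<Sum>s<n. B $$ (i, s) * (if (s, q) = (k, l) then 1 else 0))"
      using B ij that by (auto simp: scalar_prod_def atLeast0LessThan intro!: sum.cong)
    also have "\<dots> = (\<Sum>s<n. if s = k then (if q = l then B $$ (i, k) else 0) else 0)"
      by (intro sum.cong) auto
    finally show ?thesis using kl by simp
  qed
  have "(B * mat n m (\<lambda>p. if p = (k, l) then 1 else 0) * D) $$ (i, j)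
      = (\<Sum>q<m. (B * mat n m (\<lambda>p. if p = (k, l) then 1 else 0)) $$ (i, q) * D $$ (q, j))"
    using B D ij by (simp add: scalar_prod_def atLeast0LessThan)
  also have "\<dots> = (\<Sum>q<m. if q = l then B $$ (i, k) * D $$ (l, j) else 0)"
    by (intro sum.cong) (auto simp: BE)
  finally show ?thesis using kl by simp
qed

section \<open>Orthogonality relations for irreducible characters\<close>

context group
begin

lemma bij_betw_lmult: "h \<in> carrier G \<Longrightarrow> bij_betw (\<lambda>g. h \<otimes> g) (carrier G) (carrier G)"
  by (rule bij_betw_byWitness[where f' = "\<lambda>g. inv h \<otimes> g"]) (auto simp: inv_solve_left m_assoc[symmetric])

text \<open>Left multiplication by \<open>h\<close> permutes the group, so replacing
  \<open>g\<close> by \<open>h \<otimes> g\<close> in the sum moves the factor at \<open>h\<close>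
  from the left of the average to its right.\<close>

lemma averaged_intertwiner:
  assumes r: "representation G n \<rho>" and r': "representation G m \<rho>'"
    and A: "A \<in> carrier_mat n m" and h: "h \<in> carrier G"
  defines "T \<equiv> mat_sum n m (carrier G) (\<lambda>g. \<rho> g * A * \<rho>' (inv g))"
  shows "\<rho> h * T = T * \<rho>' h"
proof -
  note c = representation_carrier[OF r] representation_carrier[OF r']
  have term_in: "\<rho> g * A * \<rho>' (inv g) \<in> carrier_mat n m" if "g \<in> carrier G" for g
    using c that A by (meson inv_closed mult_carrier_mat)
  have "\<rho> h * T = mat_sum n m (carrier G) (\<lambda>g. \<rho> h * (\<rho> g * A * \<rho>' (inv g)))"
    unfolding T_def using c h term_in by (intro mult_mat_sum) auto
  also have "\<dots> = mat_sum n m (carrier G) (\<lambda>g. (\<rho> (h \<otimes> g) * A * \<rho>' (inv (h \<otimes> g))) * \<rho>' h)"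
  proof (rule mat_sum_cong)
    fix g assume g: "g \<in> carrier G"
    have "inv g = inv (h \<otimes> g) \<otimes> h"
      using g h by (simp add: inv_mult_group m_assoc)
    then have "\<rho>' (inv g) = \<rho>' (inv (h \<otimes> g)) * \<rho>' h"
      using g h representation_mult[OF r', of "inv (h \<otimes> g)" h] by simp
    then have "\<rho> h * (\<rho> g * A * \<rho>' (inv g)) = \<rho> h * (\<rho> g * A * (\<rho>' (inv (h \<otimes> g)) * \<rho>' h))"
      by simp
    also have "\<dots> = \<rho> h * (\<rho> g * A) * (\<rho>' (inv (h \<otimes> g)) * \<rho>' h)"
      using g h A c(1)[of h] c(1)[of g] c(2)[of h] c(2)[of "inv (h \<otimes> g)"]
      by (intro assoc_mult_mat[symmetric, of _ n n _ m _ m]) auto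
    also have "\<rho> h * (\<rho> g * A) = \<rho> (h \<otimes> g) * A"
      using g h A c(1)[of h] c(1)[of g]
      by (simp add: representation_mult[OF r] assoc_mult_mat[of _ n n _ n _ m])
    also have "\<rho> (h \<otimes> g) * A * (\<rho>' (inv (h \<otimes> g)) * \<rho>' h) = \<rho> (h \<otimes> g) * A * \<rho>' (inv (h \<otimes> g)) * \<rho>' h"
      using g h A c(1)[of "h \<otimes> g"] c(2)[of h] c(2)[of "inv (h \<otimes> g)"]
      by (intro assoc_mult_mat[symmetric, of _ n m _ m _ m]) auto
    finally show "\<rho> h * (\<rho> g * A * \<rho>' (inv g)) = (\<rho> (h \<otimes> g) * A * \<rho>' (inv (h \<otimes> g))) * \<rho>' h" .
  qed
  also have "\<dots> = mat_sum n m (carrier G) (\<lambda>g. (\<rho> g * A * \<rho>' (inv g)) * \<rho>' h)"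
    by (rule mat_sum_reindex[OF bij_betw_lmult[OF h], symmetric])
  also have "\<dots> = T * \<rho>' h"
    unfolding T_def using c h term_in by (intro mat_sum_mult[symmetric]) auto
  finally show ?thesis .
qed

text \<open>Expresses the pairing of two characters through averages of matrix units. These averages
  are intertwiners, so Schur's lemma evaluates every term on the right.\<close>

lemma sum_trace_products:
  assumes r: "representation G n \<rho>" and r': "representation G m \<rho>'"
  shows "(\<Sum>g\<in>carrier G. mat_trace (\<rho> g) * mat_trace (\<rho>' (inv g))) =
    (\<Sum>i<n. \<Sum>j<m. mat_sum n m (carrier G)
       (\<lambda>g. \<rho> g * mat n m (\<lambda>p. if p = (i, j) then 1 else 0) * \<rho>' (inv g)) $$ (i, j))"
proof -
  have "(\<Sum>g\<in>carrier G. mat_trace (\<rho> g) * mat_trace (\<rho>' (inv g))) =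
     (\<Sum>g\<in>carrier G. \<Sum>i<n. \<Sum>j<m. \<rho> g $$ (i, i) * \<rho>' (inv g) $$ (j, j))"
  proof (rule sum.cong[OF refl])
    fix g assume g: "g \<in> carrier G"
    then have "\<rho> g \<in> carrier_mat n n" "\<rho>' (inv g) \<in> carrier_mat m m"
      using representation_carrier[OF r] representation_carrier[OF r'] by auto
    then show "mat_trace (\<rho> g) * mat_trace (\<rho>' (inv g)) = (\<Sum>i<n. \<Sum>j<m. \<rho> g $$ (i, i) * \<rho>' (inv g) $$ (j, j))"
      by (simp add: mat_trace_def sum_product)
  qed
  also have "\<dots> = (\<Sum>i<n. \<Sum>j<m. \<Sum>g\<in>carrier G. \<rho> g $$ (i, i) * \<rho>' (inv g) $$ (j, j))"
    by (subst sum.swap) (intro sum.cong refl sum.swap)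
  also have "\<dots> = (\<Sum>i<n. \<Sum>j<m. mat_sum n m (carrier G)
       (\<lambda>g. \<rho> g * mat n m (\<lambda>p. if p = (i, j) then 1 else 0) * \<rho>' (inv g)) $$ (i, j))"
  proof (intro sum.cong refl)
    fix i j assume "i \<in> {..<n}" "j \<in> {..<m}"
    then have ij: "i < n" "j < m" by auto
    have "(\<rho> g * mat n m (\<lambda>p. if p = (i, j) then 1 else 0) * \<rho>' (inv g)) $$ (i, j) = \<rho> g $$ (i, i) * \<rho>' (inv g) $$ (j, j)"
      if "g \<in> carrier G" for g
      using mult_matrix_unit_mult[OF representation_carrier[OF r that] representation_carrier[OF r', of "inv g"] ij ij] that
      by simp
    then show "(\<Sum>g\<in>carrier G. \<rho> g $$ (i, i) * \<rho>' (inv g) $$ (j, j)) =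
      mat_sum n m (carrier G) (\<lambda>g. \<rho> g * mat n m (\<lambda>p. if p = (i, j) then 1 else 0) * \<rho>' (inv g)) $$ (i, j)"
      using ij by (simp add: mat_sum_def)
  qed
  finally show ?thesis .
qed

lemma IrrE:
  assumes "\<chi> \<in> Irr G"
  obtains n \<rho> where "irreducible_representation G n \<rho>" "representation G n \<rho>" "n > 0" "\<chi> = character_of G \<rho>"
  using assms by (auto simp: Irr_def irreducible_representation_def)

text \<open>A nonzero intertwiner would be an isomorphism and would force the characters to agree;
  hence all the averages in \<open>sum_trace_products\<close> vanish. Pairing with \<psi>(inv g)
  instead of a complex conjugate avoids any discussion of unitarity.\<close>

lemma Irr_orthogonal:
  assumes "\<chi> \<in> Irr G" "\<psi> \<in> Irr G" "\<chi> \<noteq> \<psi>"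
  shows "(\<Sum>g\<in>carrier G. \<chi> g * \<psi> (inv g)) = 0"
proof -
  obtain n \<rho> where \<rho>: "irreducible_representation G n \<rho>" "representation G n \<rho>" "\<chi> = character_of G \<rho>"
    by (rule IrrE[OF assms(1)])
  obtain m \<rho>' where \<rho>': "irreducible_representation G m \<rho>'" "representation G m \<rho>'" "\<psi> = character_of G \<rho>'"
    by (rule IrrE[OF assms(2)])
  have zero: "T = 0\<^sub>m n m"
    if T: "T \<in> carrier_mat n m" and comm: "\<And>g. g \<in> carrier G \<Longrightarrow> \<rho> g * T = T * \<rho>' g" for T
  proof (rule ccontr)
    assume "T \<noteq> 0\<^sub>m n m"
    then obtain S where S: "S \<in> carrier_mat m n" "T * S = 1\<^sub>m n" "S * T = 1\<^sub>m m"
      using schur_isomorphism[OF \<rho>(1) \<rho>'(1) T _ comm] by blast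
    \<comment> \<open>Here \<open>\<rho> g\<close> is \<open>T * \<rho>' g * S\<close>, and the
      trace allows \<open>T\<close> to be moved to the end, where it cancels against
      \<open>S\<close>.\<close>
    have "mat_trace (\<rho> g) = mat_trace (\<rho>' g)" if g: "g \<in> carrier G" for g
    proof -
      note c = representation_carrier[OF \<rho>(2) g] representation_carrier[OF \<rho>'(2) g]
      have "\<rho> g = \<rho> g * (T * S)" using c S by simp
      also have "\<dots> = (\<rho> g * T) * S" using c T S by (intro assoc_mult_mat[symmetric]) auto
      also have "\<dots> = T * (\<rho>' g * S)" unfolding comm[OF g] using c T S by (intro assoc_mult_mat) auto
      finally have "mat_trace (\<rho> g) = mat_trace ((\<rho>' g * S) * T)"
        using mat_trace_mult_comm[of T n m "\<rho>' g * S"] c T S by simp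
      also have "(\<rho>' g * S) * T = \<rho>' g * (S * T)" using c T S by (intro assoc_mult_mat) auto
      finally show ?thesis using c S by simp
    qed
    then have "\<chi> = \<psi>" unfolding \<rho>(3) \<rho>'(3) character_of_def by (intro restrict_ext) auto
    with assms(3) show False by blast
  qed
  have "(\<Sum>g\<in>carrier G. \<chi> g * \<psi> (inv g)) = (\<Sum>g\<in>carrier G. mat_trace (\<rho> g) * mat_trace (\<rho>' (inv g)))"
    by (intro sum.cong) (auto simp: \<rho> \<rho>' character_of_def)
  also have "\<dots> = 0"
    unfolding sum_trace_products[OF \<rho>(2) \<rho>'(2)]
  proof (intro sum.neutral ballI)
    fix i j assume ij: "i \<in> {..<n}" "j \<in> {..<m}"
    show "mat_sum n m (carrier G)
       (\<lambda>g. \<rho> g * mat n m (\<lambda>p. if p = (i, j) then 1 else 0) * \<rho>' (inv g)) $$ (i, j) = 0"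
      using ij by (subst zero) (auto intro: averaged_intertwiner[OF \<rho>(2) \<rho>'(2)])
  qed
  finally show ?thesis .
qed

text \<open>By Schur's lemma the average of the matrix unit at (i, j) is a scalar matrix.
  Conjugation preserves the trace, so n times the scalar is |G| if i = j and 0 otherwise. The n
  diagonal terms then contribute |G| / n each.\<close>

lemma Irr_norm:
  assumes "\<chi> \<in> Irr G"
  shows "(\<Sum>g\<in>carrier G. \<chi> g * \<chi> (inv g)) = of_nat (card (carrier G))"
proof -
  obtain n \<rho> where \<rho>: "irreducible_representation G n \<rho>" "representation G n \<rho>" "\<chi> = character_of G \<rho>" and n: "n > 0"
    by (rule IrrE[OF assms])
  have entry: "mat_sum n n (carrier G)
      (\<lambda>g. \<rho> g * mat n n (\<lambda>p. if p = (i, j) then 1 else 0) * \<rho> (inv g)) $$ (i, j)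
      = (if i = j then of_nat (card (carrier G)) / of_nat n else 0)" if ij: "i < n" "j < n" for i j
  proof -
    define E where "E = mat n n (\<lambda>p. if p = (i, j) then 1 else (0::complex))"
    define T where "T = mat_sum n n (carrier G) (\<lambda>g. \<rho> g * E * \<rho> (inv g))"
    have E: "E \<in> carrier_mat n n" by (simp add: E_def)
    obtain c where c: "T = c \<cdot>\<^sub>m 1\<^sub>m n"
      using schur_scalar[OF \<rho>(1), of T] averaged_intertwiner[OF \<rho>(2) \<rho>(2) E] unfolding T_def by auto
    have term_in: "\<rho> g * E * \<rho> (inv g) \<in> carrier_mat n n" if "g \<in> carrier G" for g
      using representation_carrier[OF \<rho>(2)] that E by (meson inv_closed mult_carrier_mat)
    have tr: "mat_trace (\<rho> g * E * \<rho> (inv g)) = mat_trace E" if g: "g \<in> carrier G" for g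
    proof -
      note r = representation_carrier[OF \<rho>(2) g] representation_carrier[OF \<rho>(2) inv_closed[OF g]]
      have "mat_trace (\<rho> g * E * \<rho> (inv g)) = mat_trace (\<rho> (inv g) * (\<rho> g * E))"
        using r E by (intro mat_trace_mult_comm) auto
      also have "\<rho> (inv g) * (\<rho> g * E) = (\<rho> (inv g) * \<rho> g) * E"
        using r E by (intro assoc_mult_mat[symmetric]) auto
      finally show ?thesis using E representation_inv[OF \<rho>(2) g] by simp
    qed
    have "c * of_nat n = mat_trace T" by (simp add: c mat_trace_smult_one)
    also have "\<dots> = (\<Sum>g\<in>carrier G. mat_trace (\<rho> g * E * \<rho> (inv g)))"
      unfolding T_def by (rule mat_trace_mat_sum) (rule term_in)
    also have "\<dots> = of_nat (card (carrier G)) * mat_trace E" by (simp add: tr)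
    also have "mat_trace E = (\<Sum>k<n. if k = i then (if i = j then 1 else 0) else 0)"
      by (auto simp: mat_trace_def E_def intro!: sum.cong)
    also have "\<dots> = (if i = j then 1 else 0)" using ij by simp
    finally have "c = (if i = j then of_nat (card (carrier G)) / of_nat n else 0)"
      using n by (auto simp: field_simps split: if_splits)
    then have "T $$ (i, j) = (if i = j then of_nat (card (carrier G)) / of_nat n else 0)"
      using ij c by auto
    then show ?thesis by (simp add: T_def E_def)
  qed
  have "(\<Sum>g\<in>carrier G. \<chi> g * \<chi> (inv g)) = (\<Sum>g\<in>carrier G. mat_trace (\<rho> g) * mat_trace (\<rho> (inv g)))"
    by (intro sum.cong) (auto simp: \<rho> character_of_def)
  also have "\<dots> = (\<Sum>i<n. \<Sum>j<n. if i = j then of_nat (card (carrier G)) / of_nat n else 0)"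
    unfolding sum_trace_products[OF \<rho>(2) \<rho>(2)] by (intro sum.cong) (auto simp: entry)
  also have "\<dots> = of_nat (card (carrier G))" using n by simp
  finally show ?thesis .
qed

lemma Irr_one_neq_0:
  assumes "\<chi> \<in> Irr G"
  shows "\<chi> \<one> \<noteq> 0"
proof -
  obtain n \<rho> where "representation G n \<rho>" "n > 0" "\<chi> = character_of G \<rho>"
    by (rule IrrE[OF assms])
  then show ?thesis by (simp add: character_of_def representation_one mat_trace_def)
qed

text \<open>Conjugation permutes \<open>N\<close>, so the sum \<open>E\<close> over \<open>N\<close>
  commutes with the representation and is a scalar. Translation by an element \<open>h\<close> of
  \<open>N\<close> also permutes \<open>N\<close>, which gives \<open>\<rho> h * E = E\<close>; if
  the scalar is nonzero, it can be cancelled.\<close>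

lemma irreducible_sum_normal:
  assumes \<rho>: "irreducible_representation G n \<rho>" and N: "N \<lhd> G"
  shows "(\<forall>h\<in>N. \<rho> h = 1\<^sub>m n) \<or> mat_sum n n N \<rho> = 0\<^sub>m n n"
proof -
  interpret N: normal N G by (rule N)
  have r: "representation G n \<rho>" using \<rho> by (simp add: irreducible_representation_def)
  note c = representation_carrier[OF r]
  define E where "E = mat_sum n n N \<rho>"
  have cN: "\<rho> h \<in> carrier_mat n n" if "h \<in> N" for h using that c by simp
  have "\<rho> g * E = E * \<rho> g" if g: "g \<in> carrier G" for g
  proof -
    have bij: "bij_betw (\<lambda>h. g \<otimes> h \<otimes> inv g) N N"
    proof (rule bij_betw_byWitness[where f' = "\<lambda>h. inv g \<otimes> h \<otimes> g"])
      show "\<forall>h\<in>N. inv g \<otimes> (g \<otimes> h \<otimes> inv g) \<otimes> g = h"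
        using g by (auto simp: m_assoc) (auto simp flip: m_assoc)
      show "\<forall>h\<in>N. g \<otimes> (inv g \<otimes> h \<otimes> g) \<otimes> inv g = h"
        using g by (auto simp: m_assoc) (auto simp flip: m_assoc)
    qed (use g in \<open>auto simp: N.inv_op_closed1 N.inv_op_closed2\<close>)
    have "\<rho> g * E = mat_sum n n N (\<lambda>h. \<rho> g * \<rho> h)"
      unfolding E_def using c[OF g] cN by (intro mult_mat_sum) auto
    also have "\<dots> = mat_sum n n N (\<lambda>h. \<rho> (g \<otimes> h \<otimes> inv g) * \<rho> g)"
      using g by (intro mat_sum_cong) (simp add: m_assoc flip: representation_mult[OF r])
    also have "\<dots> = mat_sum n n N (\<lambda>h. \<rho> h * \<rho> g)"
      by (rule mat_sum_reindex[OF bij, symmetric])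
    also have "\<dots> = E * \<rho> g"
      unfolding E_def using c[OF g] cN by (intro mat_sum_mult[symmetric]) auto
    finally show ?thesis .
  qed
  then obtain a where a: "E = a \<cdot>\<^sub>m 1\<^sub>m n"
    using schur_scalar[OF \<rho>, of E] by (auto simp: E_def)
  show ?thesis
  proof (cases "a = 0")
    case True
    then show ?thesis using a by (auto simp: E_def)
  next
    case False
    have "\<rho> h = 1\<^sub>m n" if h: "h \<in> N" for h
    proof -
      have bij: "bij_betw (\<lambda>k. h \<otimes> k) N N"
        using h by (intro bij_betw_byWitness[where f' = "\<lambda>k. inv h \<otimes> k"])
          (auto simp flip: m_assoc)
      have "\<rho> h * E = mat_sum n n N (\<lambda>k. \<rho> h * \<rho> k)"
        unfolding E_def using h cN by (intro mult_mat_sum) auto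
      also have "\<dots> = mat_sum n n N (\<lambda>k. \<rho> (h \<otimes> k))"
        using h by (intro mat_sum_cong) (simp add: representation_mult[OF r])
      also have "\<dots> = E"
        unfolding E_def by (rule mat_sum_reindex[OF bij, symmetric])
      finally have "\<rho> h * (a \<cdot>\<^sub>m 1\<^sub>m n) = a \<cdot>\<^sub>m 1\<^sub>m n" by (simp add: a)
      moreover have "\<rho> h * (a \<cdot>\<^sub>m 1\<^sub>m n) = a \<cdot>\<^sub>m \<rho> h"
        using cN[OF h] by (simp add: mult_smult_distrib[of _ n n _ n])
      ultimately have eq: "a \<cdot>\<^sub>m \<rho> h = a \<cdot>\<^sub>m 1\<^sub>m n" by simp
      show ?thesis
      proof (rule eq_matI)
        fix i j assume "i < dim_row (1\<^sub>m n :: complex mat)" "j < dim_col (1\<^sub>m n :: complex mat)"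
        then have ij: "i < n" "j < n" by auto
        from eq have "(a \<cdot>\<^sub>m \<rho> h) $$ (i, j) = (a \<cdot>\<^sub>m 1\<^sub>m n) $$ (i, j)" by simp
        then show "\<rho> h $$ (i, j) = 1\<^sub>m n $$ (i, j)"
          using ij cN[OF h] False by simp
      qed (use cN[OF h] in auto)
    qed
    then show ?thesis by blast
  qed
qed

section \<open>Sums of irreducible characters over cosets of a normal subgroup\<close>

lemma sum_r_coset:
  assumes "N \<subseteq> carrier G" "g \<in> carrier G"
  shows "(\<Sum>a\<in>N #> g. f a) = (\<Sum>h\<in>N. f (h \<otimes> g))"
proof -
  have "N #> g = (\<lambda>h. h \<otimes> g) ` N" by (auto simp: r_coset_def)
  moreover have "inj_on (\<lambda>h. h \<otimes> g) N" using inj_on_g[OF assms] .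
  ultimately show ?thesis by (simp add: sum.reindex)
qed

text \<open>The dichotomy for the representation is passed to traces: the sum over the coset of
  \<open>g\<close> is the trace of (sum over \<open>N\<close>) times
  \<open>\<rho> g\<close>.\<close>

lemma Irr_normal_cases:
  assumes \<chi>: "\<chi> \<in> Irr G" and N: "N \<lhd> G"
  shows "(\<forall>h\<in>N. \<forall>g\<in>carrier G. \<chi> (h \<otimes> g) = \<chi> g) \<or> (\<forall>g\<in>carrier G. (\<Sum>a\<in>N #> g. \<chi> a) = 0)"
proof -
  interpret N: normal N G by (rule N)
  obtain n \<rho> where \<rho>: "irreducible_representation G n \<rho>" "representation G n \<rho>" "\<chi> = character_of G \<rho>"
    by (rule IrrE[OF \<chi>])
  note c = representation_carrier[OF \<rho>(2)]
  have cN: "\<rho> h \<in> carrier_mat n n" if "h \<in> N" for h using that c by simp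
  show ?thesis
    using irreducible_sum_normal[OF \<rho>(1) N]
  proof
    assume "\<forall>h\<in>N. \<rho> h = 1\<^sub>m n"
    then have "\<chi> (h \<otimes> g) = \<chi> g" if "h \<in> N" "g \<in> carrier G" for h g
      using that c[of g] by (simp add: \<rho>(3) character_of_def representation_mult[OF \<rho>(2)])
    then show ?thesis by blast
  next
    assume z: "mat_sum n n N \<rho> = 0\<^sub>m n n"
    have "(\<Sum>a\<in>N #> g. \<chi> a) = 0" if g: "g \<in> carrier G" for g
    proof -
      have "(\<Sum>a\<in>N #> g. \<chi> a) = (\<Sum>h\<in>N. mat_trace (\<rho> h * \<rho> g))"
        unfolding sum_r_coset[OF N.subset g]
        using g by (intro sum.cong) (auto simp: \<rho>(3) character_of_def representation_mult[OF \<rho>(2)])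
      also have "\<dots> = mat_trace (mat_sum n n N (\<lambda>h. \<rho> h * \<rho> g))"
        using cN c[OF g] by (intro mat_trace_mat_sum[symmetric] mult_carrier_mat) auto
      also have "mat_sum n n N (\<lambda>h. \<rho> h * \<rho> g) = mat_sum n n N \<rho> * \<rho> g"
        using cN c[OF g] by (intro mat_sum_mult[symmetric]) auto
      also have "mat_trace \<dots> = 0" using z c[OF g] by (simp add: mat_trace_def)
      finally show ?thesis .
    qed
    then show ?thesis by blast
  qed
qed

text \<open>The kernel is defined by character values, so it must be shown that \<open>N\<close>
  really acts trivially. The sum of \<chi> over \<open>N\<close> is |N| \<chi>(1), which is nonzero,
  and this excludes the vanishing alternative of \<open>Irr_normal_cases\<close>; eigenvalues of the
  matrices need not be examined.\<close>

lemma Irr_coset_constant: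
  assumes \<chi>: "\<chi> \<in> Irr G" and N: "N \<lhd> G" and fin: "finite N" and ker: "N \<subseteq> char_kernel G \<chi>"
    and h: "h \<in> N" and g: "g \<in> carrier G"
  shows "\<chi> (h \<otimes> g) = \<chi> g"
proof -
  interpret N: normal N G by (rule N)
  have "(\<Sum>a\<in>N #> \<one>. \<chi> a) = (\<Sum>a\<in>N. \<chi> \<one>)"
    unfolding sum_r_coset[OF N.subset one_closed]
  proof (rule sum.cong[OF refl])
    fix a assume "a \<in> N"
    then have "a \<in> carrier G" "\<chi> a = \<chi> \<one>" using ker unfolding char_kernel_def by blast+
    then show "\<chi> (a \<otimes> \<one>) = \<chi> \<one>" by (metis r_one)
  qed
  also have "\<dots> = of_nat (card N) * \<chi> \<one>" by simp
  also have "\<dots> \<noteq> 0"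
  proof -
    have "card N \<noteq> 0" using fin h by auto
    then show ?thesis using Irr_one_neq_0[OF \<chi>] by simp
  qed
  finally show ?thesis using Irr_normal_cases[OF \<chi> N] h g one_closed by blast
qed

text \<open>An element of \<open>N\<close> outside the kernel, compared with the identity, refutes
  the other alternative of \<open>Irr_normal_cases\<close>.\<close>

lemma Irr_coset_sum_0:
  assumes \<chi>: "\<chi> \<in> Irr G" and N: "N \<lhd> G" and ker: "\<not> N \<subseteq> char_kernel G \<chi>"
    and g: "g \<in> carrier G"
  shows "(\<Sum>a\<in>N #> g. \<chi> a) = 0"
proof -
  interpret N: normal N G by (rule N)
  obtain h where "h \<in> N" "\<chi> h \<noteq> \<chi> \<one>" using ker by (auto simp: char_kernel_def)
  then have "\<not> (\<forall>h\<in>N. \<forall>g\<in>carrier G. \<chi> (h \<otimes> g) = \<chi> g)" by (metis N.subset one_closed r_one subsetD)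
  then show ?thesis using Irr_normal_cases[OF \<chi> N] g by blast
qed

end

section \<open>Kernels and blocks of a supercharacter theory\<close>

interpretation cfun: vector_space "\<lambda>(c::complex) (f::'a \<Rightarrow> complex) x. c * f x"
  by unfold_locales (auto simp: algebra_simps fun_eq_iff)

text \<open>Normalising to 0 outside \<open>A\<close> makes functions equal as soon as they agree on
  \<open>A\<close>, so that spans and independence depend on values on \<open>A\<close> only. With a
  subgroup for \<open>A\<close> it is also the extension that enters the formula for
  induction.\<close>

definition zero_ext :: "'a set \<Rightarrow> ('a \<Rightarrow> complex) \<Rightarrow> 'a \<Rightarrow> complex" where
  "zero_ext A f = (\<lambda>g. if g \<in> A then f g else 0)"

lemma sum_fun_apply: "(\<Sum>i\<in>I. f i) x = (\<Sum>i\<in>I. f i x)" for f :: "'i \<Rightarrow> 'a \<Rightarrow> complex"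
  by (induction I rule: infinite_finite_induct) auto

text \<open>Pairing with \<open>h j\<close> isolates the \<open>j\<close>-th function: it tells the
  functions apart, and applied to a linear relation it leaves the \<open>j\<close>-th coefficient
  times the nonzero number \<open>d j\<close>.\<close>

lemma biorthogonal_independent:
  assumes "\<And>i j. i \<in> I \<Longrightarrow> j \<in> I \<Longrightarrow> (\<Sum>g\<in>A. f i g * h j g) = (if i = j then d j else 0)"
    and "\<And>i. i \<in> I \<Longrightarrow> d i \<noteq> 0"
  shows "inj_on (\<lambda>i. zero_ext A (f i)) I" "cfun.independent ((\<lambda>i. zero_ext A (f i)) ` I)"
proof -
  have pair: "(\<Sum>g\<in>A. zero_ext A (f i) g * h j g) = (if i = j then d j else 0)" if "i \<in> I" "j \<in> I" for i j
    using assms(1)[OF that] by (simp add: zero_ext_def cong: sum.cong)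
  show inj: "inj_on (\<lambda>i. zero_ext A (f i)) I"
    by (rule inj_onI) (metis pair assms(2))
  show "cfun.independent ((\<lambda>i. zero_ext A (f i)) ` I)"
    unfolding cfun.independent_explicit_finite_subsets
  proof (intro allI impI ballI)
    fix S u v
    assume S: "S \<subseteq> (\<lambda>i. zero_ext A (f i)) ` I" "finite S"
      and u: "(\<Sum>v\<in>S. (\<lambda>x. u v * v x)) = 0" and v: "v \<in> S"
    obtain j where j: "j \<in> I" "v = zero_ext A (f j)" using S v by auto
    have pair_S: "(\<Sum>g\<in>A. w g * h j g) = (if w = v then d j else 0)" if "w \<in> S" for w
      using that S(1) j pair inj by (auto simp: inj_on_def)
    have "0 = (\<Sum>g\<in>A. (\<Sum>v\<in>S. (\<lambda>x. u v * v x)) g * h j g)"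
      by (simp add: u)
    also have "\<dots> = (\<Sum>w\<in>S. u w * (\<Sum>g\<in>A. w g * h j g))"
      by (simp add: sum_fun_apply sum_distrib_left sum_distrib_right mult.assoc) (rule sum.swap)
    also have "\<dots> = (\<Sum>w\<in>S. if w = v then u v * d j else 0)"
      by (intro sum.cong) (auto simp: pair_S)
    also have "\<dots> = u v * d j" using S v by simp
    finally show "u v = 0" using assms(2) j by simp
  qed
qed

text \<open>Such a function is the sum over the blocks of its value at a chosen point times the
  indicator of the block.\<close>

lemma block_constant_in_span:
  assumes \<K>: "partition_on A \<K>" "finite \<K>"
    and f: "\<And>K g h. K \<in> \<K> \<Longrightarrow> g \<in> K \<Longrightarrow> h \<in> K \<Longrightarrow> f g = f h"
  shows "zero_ext A f \<in> cfun.span ((\<lambda>K. zero_ext K (\<lambda>_. 1)) ` \<K>)"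
proof -
  have "zero_ext A f = (\<Sum>K\<in>\<K>. (\<lambda>g. f (SOME k. k \<in> K) * zero_ext K (\<lambda>_. 1) g))"
  proof
    fix g
    have "(\<Sum>K\<in>\<K>. (\<lambda>g. f (SOME k. k \<in> K) * zero_ext K (\<lambda>_. 1) g)) g
        = (\<Sum>K\<in>\<K>. if g \<in> K then f g else 0)"
      unfolding sum_fun_apply
    proof (rule sum.cong[OF refl])
      fix K assume "K \<in> \<K>"
      then show "f (SOME k. k \<in> K) * zero_ext K (\<lambda>_. 1) g = (if g \<in> K then f g else 0)"
        by (auto simp: zero_ext_def intro: f someI)
    qed
    also have "\<dots> = zero_ext A f g"
    proof (cases "g \<in> A")
      case True
      then obtain K where K: "K \<in> \<K>" "g \<in> K" using \<K> by (auto simp: partition_on_def)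
      have "g \<in> L \<longleftrightarrow> L = K" if "L \<in> \<K>" for L
        using \<K>(1) K that by (auto simp: partition_on_def disjoint_def)
      then have "(\<Sum>L\<in>\<K>. if g \<in> L then f g else 0) = (\<Sum>L\<in>\<K>. if L = K then f g else 0)"
        by (intro sum.cong) auto
      with K True \<K>(2) show ?thesis by (simp add: zero_ext_def)
    next
      case False
      then show ?thesis using \<K>(1) by (auto simp: zero_ext_def partition_on_def intro!: sum.neutral)
    qed
    finally show "zero_ext A f g = (\<Sum>K\<in>\<K>. (\<lambda>g. f (SOME k. k \<in> K) * zero_ext K (\<lambda>_. 1) g)) g" by simp
  qed
  also have "\<dots> \<in> cfun.span ((\<lambda>K. zero_ext K (\<lambda>_. 1)) ` \<K>)"
    by (intro cfun.span_sum cfun.span_scale cfun.span_base imageI)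
  finally show ?thesis .
qed

section \<open>Finiteness of \<open>Irr\<close>, the span of the supercharacters, and kernels within
  a block\<close>

context group
begin

text \<open>By orthogonality the irreducible characters are independent, and they lie in a space
  spanned by finitely many functions.\<close>

lemma finite_Irr:
  assumes fin: "finite (carrier G)"
  shows "finite (Irr G)"
proof -
  \<comment> \<open>Every function is constant on the blocks of the partition into singletons, so
    \<open>block_constant_in_span\<close> applies to all characters.\<close>
  let ?\<K> = "(\<lambda>g. {g}) ` carrier G"
  have orth: "(\<Sum>g\<in>carrier G. \<chi> g * \<psi> (inv g)) = (if \<chi> = \<psi> then of_nat (card (carrier G)) else 0)"
    if "\<chi> \<in> Irr G" "\<psi> \<in> Irr G" for \<chi> \<psi>
    using that Irr_orthogonal Irr_norm by simp
  have ne: "(of_nat (card (carrier G)) :: complex) \<noteq> 0" using fin by auto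
  note ind = biorthogonal_independent[where I = "Irr G" and A = "carrier G" and f = "\<lambda>\<chi>. \<chi>" and h = "\<lambda>\<psi> g. \<psi> (inv g)", OF orth ne]
  have part: "partition_on (carrier G) ?\<K>"
    by (auto simp: partition_on_def disjoint_def)
  have "(\<lambda>\<chi>. zero_ext (carrier G) \<chi>) ` Irr G \<subseteq> cfun.span ((\<lambda>K. zero_ext K (\<lambda>_. 1)) ` ?\<K>)"
    using fin by (auto intro!: block_constant_in_span[OF part])
  then have "finite ((\<lambda>\<chi>. zero_ext (carrier G) \<chi>) ` Irr G)"
    using cfun.independent_span_bound[OF _ ind(2)] fin by (meson finite_imageI)
  then show ?thesis using ind(1) by (rule finite_imageD)
qed

text \<open>Orthogonality leaves only the summand of \<chi> itself. This pairing serves both to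
  prove independence of the supercharacters and to read off coefficients.\<close>

lemma supercharacter_pairing:
  assumes fin: "finite (carrier G)" and X: "X \<subseteq> Irr G" and \<chi>: "\<chi> \<in> Irr G"
  shows "(\<Sum>g\<in>carrier G. supercharacter G X g * \<chi> (inv g)) =
    (if \<chi> \<in> X then \<chi> \<one> * of_nat (card (carrier G)) else 0)"
proof -
  have "(\<Sum>g\<in>carrier G. supercharacter G X g * \<chi> (inv g)) = (\<Sum>\<psi>\<in>X. \<psi> \<one> * (\<Sum>g\<in>carrier G. \<psi> g * \<chi> (inv g)))"
    by (simp add: supercharacter_def sum_distrib_left sum_distrib_right mult.assoc) (rule sum.swap)
  also have "\<dots> = (\<Sum>\<psi>\<in>X. if \<psi> = \<chi> then \<chi> \<one> * of_nat (card (carrier G)) else 0)"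
    using X \<chi> by (intro sum.cong) (auto simp: Irr_orthogonal Irr_norm subset_iff)
  finally show ?thesis using finite_subset[OF X finite_Irr[OF fin]] by simp
qed

text \<open>The \<open>\<sigma>\<^sub>X\<close> are independent and as many as the blocks on which they are constant, so they
  span all functions constant on the blocks.\<close>

lemma block_constant_supercharacter_sum:
  assumes fin: "finite (carrier G)" and C: "supercharacter_theory G (\<X>, \<K>)"
    and f: "\<And>K g h. K \<in> \<K> \<Longrightarrow> g \<in> K \<Longrightarrow> h \<in> K \<Longrightarrow> f g = f h"
  shows "\<exists>c. \<forall>g\<in>carrier G. f g = (\<Sum>X\<in>\<X>. c X * supercharacter G X g)"
proof -
  let ?\<sigma> = "\<lambda>X. zero_ext (carrier G) (supercharacter G X)"
  let ?B = "(\<lambda>K. zero_ext K (\<lambda>_. 1)) ` \<K>"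
  have part: "partition_on (Irr G) \<X>" "partition_on (carrier G) \<K>" and card: "card \<X> = card \<K>"
    and const: "\<And>X K g h. X \<in> \<X> \<Longrightarrow> K \<in> \<K> \<Longrightarrow> g \<in> K \<Longrightarrow> h \<in> K \<Longrightarrow> supercharacter G X g = supercharacter G X h"
    using C unfolding supercharacter_theory_def prod.case by blast+
  have fX: "finite \<X>" and fK: "finite \<K>"
    using finite_elements[OF _ part(1)] finite_elements[OF _ part(2)] fin finite_Irr[OF fin] by auto
  have Xsub: "X \<subseteq> Irr G" if "X \<in> \<X>" for X using that part(1) by (auto simp: partition_on_def)
  have "\<forall>X\<in>\<X>. \<exists>\<chi>. \<chi> \<in> X" using partition_onD3[OF part(1)] by (metis ex_in_conv)
  \<comment> \<open>One character is chosen from each block; pairing with it detects exactly the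
    supercharacter of that block, which gives the dual family for
    \<open>biorthogonal_independent\<close>.\<close>
  then obtain r where r: "\<And>X. X \<in> \<X> \<Longrightarrow> r X \<in> X" by metis
  have rX: "r Y \<in> X \<longleftrightarrow> X = Y" if "X \<in> \<X>" "Y \<in> \<X>" for X Y
    using part(1) that r[OF that(2)] by (auto simp: partition_on_def disjoint_def)
  have pair: "(\<Sum>g\<in>carrier G. supercharacter G X g * r Y (inv g)) =
      (if X = Y then r Y \<one> * of_nat (card (carrier G)) else 0)" if "X \<in> \<X>" "Y \<in> \<X>" for X Y
  proof -
    have "r Y \<in> Irr G" using r Xsub that by blast
    from supercharacter_pairing[OF fin Xsub[OF that(1)] this] show ?thesis
      using rX[OF that] by simp
  qed
  have ne: "r Y \<one> * of_nat (card (carrier G)) \<noteq> 0" if "Y \<in> \<X>" for Y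
    using Irr_one_neq_0 r Xsub that fin by auto
  note ind = biorthogonal_independent[where I = \<X> and A = "carrier G" and f = "supercharacter G"
      and h = "\<lambda>Y g. r Y (inv g)", OF pair ne]
  have sub: "?\<sigma> ` \<X> \<subseteq> cfun.span ?B"
    using const by (auto intro!: block_constant_in_span[OF part(2) fK])
  have f_in: "zero_ext (carrier G) f \<in> cfun.span ?B"
    using f by (rule block_constant_in_span[OF part(2) fK])
  \<comment> \<open>Dimension count: if \<open>f\<close> were outside the span, adjoining it would
    give one more than \<open>card \<X>\<close> independent functions in a space spanned by at most
    \<open>card \<K> = card \<X>\<close> indicators.\<close>
  have "zero_ext (carrier G) f \<in> cfun.span (?\<sigma> ` \<X>)"
  proof (rule ccontr)
    assume n: "zero_ext (carrier G) f \<notin> cfun.span (?\<sigma> ` \<X>)"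
    then have "cfun.independent (insert (zero_ext (carrier G) f) (?\<sigma> ` \<X>))"
      by (rule cfun.independent_insertI[OF _ ind(2)])
    then have "card (insert (zero_ext (carrier G) f) (?\<sigma> ` \<X>)) \<le> card ?B"
      using cfun.independent_span_bound[of ?B] fK sub f_in by blast
    also have "\<dots> \<le> card \<X>" using card_image_le[OF fK] card by simp
    finally show False
      using n cfun.span_base[of _ "?\<sigma> ` \<X>"] fX card_image[OF ind(1)] by (subst (asm) card_insert_disjoint) auto
  qed
  then obtain u where u: "zero_ext (carrier G) f = (\<Sum>v\<in>?\<sigma> ` \<X>. (\<lambda>x. u v * v x))"
    using cfun.span_finite[of "?\<sigma> ` \<X>"] fX by auto
  have "f g = (\<Sum>X\<in>\<X>. u (?\<sigma> X) * supercharacter G X g)" if g: "g \<in> carrier G" for g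
  proof -
    have "f g = zero_ext (carrier G) f g" using g by (simp add: zero_ext_def)
    also have "\<dots> = (\<Sum>X\<in>\<X>. u (?\<sigma> X) * ?\<sigma> X g)"
      unfolding u sum_fun_apply by (rule sum.reindex_cong[OF ind(1)]) simp_all
    finally show ?thesis using g by (simp add: zero_ext_def)
  qed
  then show ?thesis by (intro exI[of _ "\<lambda>X. u (?\<sigma> X)"]) blast
qed

text \<open>If \<open>X\<close> is the block of \<open>\<chi>\<close>, the coefficient of \<open>\<sigma>\<^sub>X\<close> in the indicator function of \<open>N\<close> is
  nonzero exactly when \<open>N\<close> lies in the kernel of \<open>\<chi>\<close>.\<close>

lemma C_normal_kernel_block:
  assumes fin: "finite (carrier G)" and C: "supercharacter_theory G (\<X>, \<K>)"
    and N: "C_normal G (\<X>, \<K>) N" and X: "X \<in> \<X>" and \<chi>: "\<chi> \<in> X" and \<psi>: "\<psi> \<in> X"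
    and ker: "N \<subseteq> char_kernel G \<chi>"
  shows "N \<subseteq> char_kernel G \<psi>"
proof (rule ccontr)
  assume nker: "\<not> N \<subseteq> char_kernel G \<psi>"
  obtain \<A> where normal: "N \<lhd> G" and \<A>: "\<A> \<subseteq> \<K>" "N = \<Union>\<A>" using N by (auto simp: C_normal_def)
  interpret N: normal N G by (rule normal)
  have part: "partition_on (Irr G) \<X>" "partition_on (carrier G) \<K>"
    using C unfolding supercharacter_theory_def prod.case by blast+
  have fX: "finite \<X>" using finite_elements[OF finite_Irr[OF fin] part(1)] .
  have Xsub: "Y \<subseteq> Irr G" if "Y \<in> \<X>" for Y using that part(1) by (auto simp: partition_on_def)
  have finN: "finite N" using fin N.subset finite_subset by blast
  define f where "f = (\<lambda>g. if g \<in> N then 1 else (0::complex))"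
  \<comment> \<open>\<open>N\<close> is a union of blocks and blocks are disjoint, so each block
    lies inside \<open>N\<close> or misses it.\<close>
  have "f g = f h" if "K \<in> \<K>" "g \<in> K" "h \<in> K" for K g h
  proof -
    have "K \<subseteq> N \<or> K \<inter> N = {}"
      using \<A> that(1) part(2) by (fastforce simp: partition_on_def disjoint_def)
    then show ?thesis using that by (auto simp: f_def)
  qed
  then obtain c where c: "\<And>g. g \<in> carrier G \<Longrightarrow> f g = (\<Sum>Y\<in>\<X>. c Y * supercharacter G Y g)"
    using block_constant_supercharacter_sum[OF fin C, of f] by blast
  \<comment> \<open>Pairing the expansion of the indicator with a member of \<open>X\<close>
    isolates the coefficient \<open>c X\<close>, the same one for all members of the block.\<close>
  have key: "(\<Sum>h\<in>N. \<phi> h) = c X * (\<phi> \<one> * of_nat (card (carrier G)))" if \<phi>: "\<phi> \<in> X" for \<phi>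
  proof -
    \<comment> \<open>The pairing involves values at inverses, and inversion permutes
      \<open>N\<close>.\<close>
    have "(\<Sum>h\<in>N. \<phi> h) = (\<Sum>h\<in>N. \<phi> (inv h))"
      by (rule sum.reindex_bij_betw[symmetric], rule bij_betw_byWitness[where f' = "\<lambda>h. inv h"]) auto
    also have "\<dots> = (\<Sum>g\<in>carrier G. f g * \<phi> (inv g))"
      using fin N.subset by (intro sum.mono_neutral_cong_left) (auto simp: f_def)
    also have "\<dots> = (\<Sum>g\<in>carrier G. \<Sum>Y\<in>\<X>. c Y * (supercharacter G Y g * \<phi> (inv g)))"
      by (intro sum.cong) (simp_all add: c sum_distrib_right mult.assoc)
    also have "\<dots> = (\<Sum>Y\<in>\<X>. c Y * (\<Sum>g\<in>carrier G. supercharacter G Y g * \<phi> (inv g)))"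
      by (subst sum.swap) (simp add: sum_distrib_left)
    also have "\<dots> = (\<Sum>Y\<in>\<X>. if Y = X then c X * (\<phi> \<one> * of_nat (card (carrier G))) else 0)"
    proof (rule sum.cong[OF refl])
      fix Y assume Y: "Y \<in> \<X>"
      have "\<phi> \<in> Y \<longleftrightarrow> Y = X" using part(1) X Y \<phi> by (auto simp: partition_on_def disjoint_def)
      moreover have "\<phi> \<in> Irr G" using Xsub X \<phi> by blast
      ultimately show "c Y * (\<Sum>g\<in>carrier G. supercharacter G Y g * \<phi> (inv g))
         = (if Y = X then c X * (\<phi> \<one> * of_nat (card (carrier G))) else 0)"
        using supercharacter_pairing[OF fin Xsub[OF Y], of \<phi>] by simp
    qed
    also have "\<dots> = c X * (\<phi> \<one> * of_nat (card (carrier G)))" using fX X by simp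
    finally show ?thesis .
  qed
  have \<psi>I: "\<psi> \<in> Irr G" using Xsub X \<psi> by blast
  \<comment> \<open>The sum of \<psi> over \<open>N\<close> is a coset sum and vanishes, so
    \<open>c X\<close> is 0. The sum of \<chi> over \<open>N\<close> must then be 0 as well,
    although it equals |N| \<chi>(1).\<close>
  have "N #> \<one> = N" using N.subset by simp
  with Irr_coset_sum_0[OF \<psi>I normal nker one_closed] key[OF \<psi>] Irr_one_neq_0[OF \<psi>I] fin
  have "c X = 0" by auto
  with key[OF \<chi>] have "(\<Sum>h\<in>N. \<chi> h) = 0" by simp
  moreover have "(\<Sum>h\<in>N. \<chi> h) = (\<Sum>h\<in>N. \<chi> \<one>)"
    by (intro sum.cong refl) (use ker in \<open>unfold char_kernel_def, blast\<close>)
  moreover have "\<chi> \<one> \<noteq> 0" using Irr_one_neq_0 Xsub X \<chi> by blast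
  moreover have "card N \<noteq> 0" using finN nker by auto
  ultimately show False by simp
qed

end

section \<open>Coset sums of monomial characters\<close>

text \<open>Together with \<open>linear_charactersD\<close> this allows linear characters to be
  handled as multiplicative functions instead of representations by 1 x 1 matrices.\<close>

lemma (in group) linear_charactersI:
  assumes ext: "\<mu> \<in> extensional (carrier G)" and one: "\<mu> \<one> = 1"
    and mult: "\<And>g h. g \<in> carrier G \<Longrightarrow> h \<in> carrier G \<Longrightarrow> \<mu> (g \<otimes> h) = \<mu> g * \<mu> h"
  shows "\<mu> \<in> linear_characters G"
proof -
  define \<rho> where "\<rho> = (\<lambda>g. mat 1 1 (\<lambda>_. \<mu> g))"
  have prod: "\<rho> g * \<rho> h = \<rho> (g \<otimes> h)" if "g \<in> carrier G" "h \<in> carrier G" for g h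
    by (rule eq_matI) (auto simp: \<rho>_def mult[OF that] scalar_prod_def)
  have "\<rho> \<one> = 1\<^sub>m 1"
    by (rule eq_matI) (auto simp: \<rho>_def one)
  then have inverse: "\<rho> (inv g) * \<rho> g = 1\<^sub>m 1" "\<rho> g * \<rho> (inv g) = 1\<^sub>m 1" if "g \<in> carrier G" for g
    using that by (simp_all add: prod)
  have "\<rho> g \<in> Units (ring_mat TYPE(complex) 1 ())" if "g \<in> carrier G" for g
  proof -
    have "\<rho> h \<in> carrier_mat 1 1" for h by (simp add: \<rho>_def)
    then show ?thesis
      unfolding Units_def ring_mat_def using inverse[OF that] by auto
  qed
  then have "representation G 1 \<rho>"
    unfolding representation_def hom_def units_of_def by (auto simp: prod ring_mat_def)
  moreover have "character_of G \<rho> = \<mu>"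
    using ext by (auto simp: character_of_def mat_trace_def \<rho>_def extensional_def fun_eq_iff)
  ultimately show ?thesis by (auto simp: linear_characters_def)
qed

lemma (in group) linear_charactersD:
  assumes "\<mu> \<in> linear_characters G"
  shows "\<mu> \<one> = 1"
    and "g \<in> carrier G \<Longrightarrow> h \<in> carrier G \<Longrightarrow> \<mu> (g \<otimes> h) = \<mu> g * \<mu> h"
proof -
  obtain \<rho> where \<rho>: "representation G 1 \<rho>" and \<mu>: "\<mu> = character_of G \<rho>"
    using assms by (auto simp: linear_characters_def)
  show "\<mu> \<one> = 1"
    by (simp add: \<mu> character_of_def representation_one[OF \<rho>] mat_trace_def)
  show "\<mu> (g \<otimes> h) = \<mu> g * \<mu> h" if "g \<in> carrier G" "h \<in> carrier G"
    using that representation_carrier[OF \<rho>, of g] representation_carrier[OF \<rho>, of h]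
    by (auto simp: \<mu> character_of_def representation_mult[OF \<rho>] mat_trace_def scalar_prod_def)
qed

section \<open>Coset sums in a finite group and their conjugates\<close>

locale finite_normal = normal N G for N and G (structure) +
  assumes finite_carrier: "finite (carrier G)"
begin

lemma quotient_map_hom: "group_hom G (G Mod N) (\<lambda>g. N #> g)"
  using r_coset_hom_Mod factorgroup_is_group
  by (simp add: group_hom_def group_hom_axioms_def)

lemma finite_N: "finite N"
  using finite_carrier subset finite_subset by blast

lemma card_N_neq_0: "of_nat (card N) \<noteq> (0::complex)"
proof -
  have "N \<noteq> {}" using subgroup_axioms subgroup.one_closed by blast
  then show ?thesis using finite_N by simp
qed

lemma coset_mem_iff: "a \<in> carrier G \<Longrightarrow> g \<in> carrier G \<Longrightarrow> a \<in> N #> g \<longleftrightarrow> N #> a = N #> g"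
  using repr_independence repr_independenceD subgroup_axioms by metis

text \<open>The elements of \<open>H\<close> are grouped by their coset; those belonging to
  \<open>B\<close> form \<open>B \<inter> H\<close>.\<close>

lemma coset_sum_fibres:
  fixes F :: "'a set \<Rightarrow> complex"
  assumes "H \<subseteq> carrier G"
  shows "(\<Sum>h\<in>H. F (N #> h)) = (\<Sum>B\<in>(\<lambda>h. N #> h) ` H. of_nat (card (B \<inter> H)) * F B)"
proof -
  have "finite H" using assms finite_carrier finite_subset by blast
  then have "(\<Sum>h\<in>H. F (N #> h)) = (\<Sum>B\<in>(\<lambda>h. N #> h) ` H. \<Sum>h\<in>{h \<in> H. N #> h = B}. F (N #> h))"
    by (rule sum.image_gen)
  also have "\<dots> = (\<Sum>B\<in>(\<lambda>h. N #> h) ` H. of_nat (card (B \<inter> H)) * F B)"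
  proof (rule sum.cong[OF refl])
    fix B assume "B \<in> (\<lambda>h. N #> h) ` H"
    then have "{h \<in> H. N #> h = B} = B \<inter> H" using assms coset_mem_iff by blast
    moreover have "(\<Sum>h\<in>{h \<in> H. N #> h = B}. F (N #> h)) = (\<Sum>h\<in>{h \<in> H. N #> h = B}. F B)"
      by (rule sum.cong) auto
    ultimately show "(\<Sum>h\<in>{h \<in> H. N #> h = B}. F (N #> h)) = of_nat (card (B \<inter> H)) * F B" by simp
  qed
  finally show ?thesis .
qed

text \<open>For \<open>h\<close> in \<open>H\<close>, a product \<open>n \<otimes> h\<close> lies in
  \<open>H\<close> exactly when \<open>n\<close> does, so only \<open>N \<inter> H\<close>
  contributes. Multiplicativity is a hypothesis on \<mu> so that the constant 1 may be used too,
  which counts elements.\<close>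

lemma coset_sum_zero_ext:
  assumes H: "subgroup H G" and h: "h \<in> H"
    and mult: "\<And>k l. k \<in> H \<Longrightarrow> l \<in> H \<Longrightarrow> \<mu> (k \<otimes> l) = \<mu> k * \<mu> l"
  shows "(\<Sum>b\<in>N #> h. zero_ext H \<mu> b) = (\<Sum>n\<in>N \<inter> H. \<mu> n) * \<mu> h"
proof -
  have hG: "h \<in> carrier G" using H h subgroup.subset by blast
  have iff: "n \<otimes> h \<in> H \<longleftrightarrow> n \<in> H" if n: "n \<in> N" for n
  proof
    assume "n \<otimes> h \<in> H"
    then have "n \<otimes> h \<otimes> inv h \<in> H" using H h by (metis subgroupE(3,4))
    moreover have "n \<otimes> h \<otimes> inv h = n" using n hG subset by (auto simp: m_assoc)
    ultimately show "n \<in> H" by simp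
  qed (use H h subgroupE(4) in metis)
  have "(\<Sum>b\<in>N #> h. zero_ext H \<mu> b) = (\<Sum>n\<in>N. zero_ext H \<mu> (n \<otimes> h))"
    by (rule sum_r_coset[OF subset hG])
  also have "\<dots> = (\<Sum>n\<in>N \<inter> H. \<mu> n * \<mu> h)"
    using finite_N h by (intro sum.mono_neutral_cong_right) (auto simp: zero_ext_def iff mult)
  finally show ?thesis by (simp add: sum_distrib_right)
qed

lemma coset_sum_zero_ext_disjoint:
  assumes "H \<subseteq> carrier G" "B \<in> carrier (G Mod N)" "B \<notin> (\<lambda>h. N #> h) ` H"
  shows "(\<Sum>b\<in>B. zero_ext H \<mu> b) = 0"
proof (rule sum.neutral, rule ballI)
  fix b assume b: "b \<in> B"
  have "b \<notin> H"
  proof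
    assume bH: "b \<in> H"
    obtain g where "g \<in> carrier G" "B = N #> g" using assms(2) by (auto simp: carrier_FactGroup)
    then have "B = N #> b" using b bH assms(1) coset_mem_iff by blast
    with assms(3) bH show False by blast
  qed
  then show "zero_ext H \<mu> b = 0" by (simp add: zero_ext_def)
qed

text \<open>Every coset of \<open>N\<close> that meets \<open>H\<close> does so in |N \<inter> H|
  elements, by the preceding coset sums with the constant function 1.\<close>

lemma card_subgroup_image:
  assumes H: "subgroup H G"
  shows "card H = card (N \<inter> H) * card ((\<lambda>h. N #> h) ` H)"
proof -
  have sub: "H \<subseteq> carrier G" using H by (rule subgroup.subset)
  have "card (B \<inter> H) = card (N \<inter> H)" if B: "B \<in> (\<lambda>h. N #> h) ` H" for B
  proof -
    obtain h where h: "h \<in> H" "B = N #> h" using B by auto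
    have "B \<subseteq> carrier G" using h sub subset r_coset_subset_G by blast
    then have "finite B" using finite_carrier finite_subset by blast
    then have "of_nat (card (B \<inter> H)) = (\<Sum>b\<in>B. zero_ext H (\<lambda>_. 1) b)"
      by (simp add: zero_ext_def sum.If_cases)
    also have "\<dots> = of_nat (card (N \<inter> H))"
      unfolding h(2) by (subst coset_sum_zero_ext[OF H h(1)]) auto
    finally show ?thesis by (simp only: of_nat_eq_iff)
  qed
  then have "(of_nat (card H) :: complex) = of_nat (card (N \<inter> H) * card ((\<lambda>h. N #> h) ` H))"
    using coset_sum_fibres[OF sub, of "\<lambda>_. 1"] by simp
  then show ?thesis by (simp only: of_nat_eq_iff)
qed

text \<open>Conjugation in \<open>G\<close> maps the coset of \<open>g\<close> bijectively onto the
  corresponding conjugate in the quotient. Hence the sum depends on \<open>x\<close> only through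
  its coset.\<close>

lemma coset_sum_conj:
  assumes g: "g \<in> carrier G" and x: "x \<in> carrier G"
  shows "(\<Sum>a\<in>N #> g. f (inv x \<otimes> a \<otimes> x)) =
    (\<Sum>b\<in>inv\<^bsub>G Mod N\<^esub> (N #> x) \<otimes>\<^bsub>G Mod N\<^esub> (N #> g) \<otimes>\<^bsub>G Mod N\<^esub> (N #> x). f b)"
proof -
  interpret \<pi>: group_hom G "G Mod N" "\<lambda>g. N #> g" by (rule quotient_map_hom)
  have \<pi>: "N #> (inv y \<otimes> a \<otimes> y) = inv\<^bsub>G Mod N\<^esub> (N #> y) \<otimes>\<^bsub>G Mod N\<^esub> (N #> a) \<otimes>\<^bsub>G Mod N\<^esub> (N #> y)"
    if "a \<in> carrier G" "y \<in> carrier G" for a y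
    using that \<pi>.hom_mult \<pi>.hom_inv by (metis inv_closed m_closed)
  have sub: "N #> h \<subseteq> carrier G" if "h \<in> carrier G" for h
    using r_coset_subset_G[OF subset that] .
  let ?B = "N #> (inv x \<otimes> g \<otimes> x)"
  have "bij_betw (\<lambda>a. inv x \<otimes> a \<otimes> x) (N #> g) ?B"
  proof (rule bij_betw_byWitness[where f' = "\<lambda>b. x \<otimes> b \<otimes> inv x"])
    show "\<forall>a\<in>N #> g. x \<otimes> (inv x \<otimes> a \<otimes> x) \<otimes> inv x = a"
    proof
      fix a assume "a \<in> N #> g"
      then have "a \<in> carrier G" using sub g by blast
      then show "x \<otimes> (inv x \<otimes> a \<otimes> x) \<otimes> inv x = a"
        using x by (simp add: m_assoc) (simp flip: m_assoc)
    qed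
    show "\<forall>b\<in>?B. inv x \<otimes> (x \<otimes> b \<otimes> inv x) \<otimes> x = b"
    proof
      fix b assume "b \<in> ?B"
      then have "b \<in> carrier G" using sub[of "inv x \<otimes> g \<otimes> x"] g x by blast
      then show "inv x \<otimes> (x \<otimes> b \<otimes> inv x) \<otimes> x = b"
        using x by (simp add: m_assoc) (simp flip: m_assoc)
    qed
    show "(\<lambda>a. inv x \<otimes> a \<otimes> x) ` (N #> g) \<subseteq> ?B"
    proof (rule image_subsetI)
      fix a assume a: "a \<in> N #> g"
      then have aG: "a \<in> carrier G" using sub g by blast
      with a g have "N #> a = N #> g" by (simp add: coset_mem_iff)
      then have "N #> (inv x \<otimes> a \<otimes> x) = ?B" using aG g x by (simp only: \<pi>)
      then show "inv x \<otimes> a \<otimes> x \<in> ?B" using aG g x by (subst coset_mem_iff) auto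
    qed
    show "(\<lambda>b. x \<otimes> b \<otimes> inv x) ` ?B \<subseteq> N #> g"
    proof (rule image_subsetI)
      fix b assume b: "b \<in> ?B"
      then have bG: "b \<in> carrier G" using sub[of "inv x \<otimes> g \<otimes> x"] g x by blast
      with b g x have "N #> b = ?B" by (subst coset_mem_iff[symmetric]) auto
      \<comment> \<open>The backward map is conjugation by \<open>inv x\<close>, so the homomorphism
        rule is used at \<open>inv x\<close> and a double inverse appears.\<close>
      then have "N #> (inv (inv x) \<otimes> b \<otimes> inv x) = N #> (inv (inv x) \<otimes> (inv x \<otimes> g \<otimes> x) \<otimes> inv x)"
        using bG g x by (simp only: \<pi> inv_closed m_closed)
      also have "inv (inv x) \<otimes> (inv x \<otimes> g \<otimes> x) \<otimes> inv x = g"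
        using g x by (simp add: m_assoc) (simp flip: m_assoc)
      finally show "x \<otimes> b \<otimes> inv x \<in> N #> g" using bG g x by (subst coset_mem_iff) auto
    qed
  qed
  then have "(\<Sum>a\<in>N #> g. f (inv x \<otimes> a \<otimes> x)) = (\<Sum>b\<in>?B. f b)"
    by (rule sum.reindex_bij_betw)
  then show ?thesis using g x by (simp only: \<pi>)
qed

text \<open>After exchanging the sums, the inner sum depends only on the coset of the conjugating
  element, and each coset occurs |N| times.\<close>

lemma coset_sum_induced_char:
  assumes H: "H \<subseteq> carrier G" and A: "A \<in> carrier (G Mod N)"
  shows "(\<Sum>a\<in>A. induced_char G H \<mu> a) =
    of_nat (card N) * (\<Sum>X\<in>carrier (G Mod N).
      \<Sum>b\<in>inv\<^bsub>G Mod N\<^esub> X \<otimes>\<^bsub>G Mod N\<^esub> A \<otimes>\<^bsub>G Mod N\<^esub> X. zero_ext H \<mu> b) / of_nat (card H)"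
proof -
  obtain g where g: "g \<in> carrier G" "A = N #> g" using A by (auto simp: carrier_FactGroup)
  define \<Lambda> where "\<Lambda> = (\<lambda>X. \<Sum>b\<in>inv\<^bsub>G Mod N\<^esub> X \<otimes>\<^bsub>G Mod N\<^esub> A \<otimes>\<^bsub>G Mod N\<^esub> X. zero_ext H \<mu> b)"
  have "(\<Sum>a\<in>A. induced_char G H \<mu> a) =
      (\<Sum>a\<in>A. \<Sum>x\<in>carrier G. zero_ext H \<mu> (inv x \<otimes> a \<otimes> x)) / of_nat (card H)"
    by (simp add: induced_char_def zero_ext_def Let_def sum_divide_distrib)
  also have "(\<Sum>a\<in>A. \<Sum>x\<in>carrier G. zero_ext H \<mu> (inv x \<otimes> a \<otimes> x)) = (\<Sum>x\<in>carrier G. \<Lambda> (N #> x))"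
    by (subst sum.swap) (simp add: \<Lambda>_def g coset_sum_conj)
  also have "\<dots> = (\<Sum>X\<in>(\<lambda>x. N #> x) ` carrier G. of_nat (card (X \<inter> carrier G)) * \<Lambda> X)"
    by (rule coset_sum_fibres) simp
  also have "\<dots> = (\<Sum>X\<in>carrier (G Mod N). of_nat (card N) * \<Lambda> X)"
    unfolding carrier_FactGroup
  proof (rule sum.cong[OF refl])
    fix X assume "X \<in> (\<lambda>x. N #> x) ` carrier G"
    then have "X \<in> rcosets N" "X \<subseteq> carrier G"
      using subset r_coset_subset_G rcosetsI by auto
    then have "card (X \<inter> carrier G) = card N"
      using card_rcosets_equal[OF _ subset] by (simp add: Int_absorb2)
    then show "of_nat (card (X \<inter> carrier G)) * \<Lambda> X = of_nat (card N) * \<Lambda> X" by simp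
  qed
  finally show ?thesis by (simp add: \<Lambda>_def sum_distrib_left)
qed

text \<open>The choice of \<open>h\<close> does not matter when \<mu> is trivial on
  \<open>N \<inter> H\<close>, the only case in which this is used as a character. Restricting to
  the image of \<open>H\<close> gives the extensionality required of characters.\<close>

definition coset_char :: "'a set \<Rightarrow> ('a \<Rightarrow> complex) \<Rightarrow> 'a set \<Rightarrow> complex" where
  "coset_char H \<mu> = (\<lambda>B\<in>(\<lambda>h. N #> h) ` H. \<mu> (SOME h. h \<in> B \<inter> H))"

section \<open>Descent of one linear character to the quotient\<close>

context
  fixes H \<mu>
  assumes H: "subgroup H G"
    and \<mu>: "\<mu> \<in> linear_characters (G\<lparr>carrier := H\<rparr>)"
begin

lemma linear_character_mult: "k \<in> H \<Longrightarrow> l \<in> H \<Longrightarrow> \<mu> (k \<otimes> l) = \<mu> k * \<mu> l"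
  using group.linear_charactersD(2)[OF subgroup_imp_group[OF H] \<mu>] by simp

lemma linear_character_one: "\<mu> \<one> = 1"
  using group.linear_charactersD(1)[OF subgroup_imp_group[OF H] \<mu>] by simp

text \<open>Two elements of \<open>H\<close> in the same coset differ by an element of
  \<open>N \<inter> H\<close>, on which \<mu> is 1.\<close>

lemma coset_char_eq:
  assumes triv: "\<forall>n\<in>N \<inter> H. \<mu> n = 1" and h: "h \<in> H"
  shows "coset_char H \<mu> (N #> h) = \<mu> h"
proof -
  have HG: "H \<subseteq> carrier G" using H by (rule subgroup.subset)
  define k where "k = (SOME k. k \<in> (N #> h) \<inter> H)"
  have "h \<in> (N #> h) \<inter> H" using h HG rcos_self subgroup_axioms by blast
  then have k: "k \<in> N #> h" "k \<in> H" unfolding k_def by (metis (mono_tags, lifting) IntD1 IntD2 someI)+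
  then obtain n where n: "n \<in> N" "k = n \<otimes> h" by (auto simp: r_coset_def)
  have "n = k \<otimes> inv h" using n h HG subset by (auto simp: m_assoc)
  then have nH: "n \<in> H" using k(2) h H by (metis subgroupE(3,4))
  then have "\<mu> k = \<mu> h" using n h triv by (simp add: linear_character_mult)
  then show ?thesis using h by (simp add: coset_char_def k_def)
qed

lemma coset_char_linear:
  assumes triv: "\<forall>n\<in>N \<inter> H. \<mu> n = 1"
  shows "subgroup ((\<lambda>h. N #> h) ` H) (G Mod N)"
    and "coset_char H \<mu> \<in> linear_characters ((G Mod N)\<lparr>carrier := (\<lambda>h. N #> h) ` H\<rparr>)"
proof -
  interpret \<pi>: group_hom G "G Mod N" "\<lambda>g. N #> g" by (rule quotient_map_hom)
  have HG: "H \<subseteq> carrier G" using H by (rule subgroup.subset)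
  show sub: "subgroup ((\<lambda>h. N #> h) ` H) (G Mod N)"
    by (rule \<pi>.subgroup_img_is_subgroup[OF H])
  show "coset_char H \<mu> \<in> linear_characters ((G Mod N)\<lparr>carrier := (\<lambda>h. N #> h) ` H\<rparr>)"
  proof (rule group.linear_charactersI[OF \<pi>.H.subgroup_imp_group[OF sub]])
    show "coset_char H \<mu> \<in> extensional (carrier ((G Mod N)\<lparr>carrier := (\<lambda>h. N #> h) ` H\<rparr>))"
      by (simp add: coset_char_def)
    have "\<one> \<in> H" using H by (rule subgroup.one_closed)
    from coset_char_eq[OF triv this] have "coset_char H \<mu> (N #> \<one>) = 1"
      by (simp add: linear_character_one)
    then show "coset_char H \<mu> \<one>\<^bsub>(G Mod N)\<lparr>carrier := (\<lambda>h. N #> h) ` H\<rparr>\<^esub> = 1"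
      using subset by simp
  next
    fix A B assume "A \<in> carrier ((G Mod N)\<lparr>carrier := (\<lambda>h. N #> h) ` H\<rparr>)"
      and "B \<in> carrier ((G Mod N)\<lparr>carrier := (\<lambda>h. N #> h) ` H\<rparr>)"
    then obtain h k where hk: "h \<in> H" "k \<in> H" "A = N #> h" "B = N #> k" by auto
    have "A \<otimes>\<^bsub>G Mod N\<^esub> B = N #> (h \<otimes> k)"
      using hk HG \<pi>.hom_mult[of h k] by (simp add: subset_iff)
    moreover have "h \<otimes> k \<in> H" using H hk by (metis subgroupE(4))
    ultimately show "coset_char H \<mu> (A \<otimes>\<^bsub>(G Mod N)\<lparr>carrier := (\<lambda>h. N #> h) ` H\<rparr>\<^esub> B) = coset_char H \<mu> A * coset_char H \<mu> B"
      using hk by (simp add: coset_char_eq[OF triv] linear_character_mult)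
  qed
qed

text \<open>The sum of the extended \<mu> over a coset is |N \<inter> H| times the descended
  character extended by 0. The factor |N \<inter> H| / |H| is the reciprocal of the order of the
  image of \<open>H\<close>, which is the normalisation of induction in the quotient.\<close>

lemma coset_sum_induced_trivial:
  assumes triv: "\<forall>n\<in>N \<inter> H. \<mu> n = 1" and A: "A \<in> carrier (G Mod N)"
  shows "(\<Sum>a\<in>A. induced_char G H \<mu> a) =
    of_nat (card N) * induced_char (G Mod N) ((\<lambda>h. N #> h) ` H) (coset_char H \<mu>) A"
proof -
  interpret Q: group "G Mod N" by (rule factorgroup_is_group)
  have HG: "H \<subseteq> carrier G" using H by (rule subgroup.subset)
  have "N \<inter> H \<noteq> {}" using H subgroup.one_closed subgroup_axioms by blast
  then have ne: "card (N \<inter> H) \<noteq> 0" using finite_N by simp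
  have term_eq: "(\<Sum>b\<in>B. zero_ext H \<mu> b) =
      of_nat (card (N \<inter> H)) * (if B \<in> (\<lambda>h. N #> h) ` H then coset_char H \<mu> B else 0)"
    if B: "B \<in> carrier (G Mod N)" for B
  proof (cases "B \<in> (\<lambda>h. N #> h) ` H")
    case True
    then obtain h where h: "h \<in> H" "B = N #> h" by auto
    then show ?thesis
      using triv by (simp add: coset_sum_zero_ext[OF H h(1) linear_character_mult] coset_char_eq[OF triv])
  qed (simp add: coset_sum_zero_ext_disjoint[OF HG B])
  have "(\<Sum>a\<in>A. induced_char G H \<mu> a) = of_nat (card N) * (\<Sum>X\<in>carrier (G Mod N).
      of_nat (card (N \<inter> H)) * (if inv\<^bsub>G Mod N\<^esub> X \<otimes>\<^bsub>G Mod N\<^esub> A \<otimes>\<^bsub>G Mod N\<^esub> X \<in> (\<lambda>h. N #> h) ` H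
        then coset_char H \<mu> (inv\<^bsub>G Mod N\<^esub> X \<otimes>\<^bsub>G Mod N\<^esub> A \<otimes>\<^bsub>G Mod N\<^esub> X) else 0)) / of_nat (card H)"
    unfolding coset_sum_induced_char[OF HG A]
    using A by (intro arg_cong2[where f = "(/)"] arg_cong2[where f = "(*)"] refl sum.cong term_eq) blast
  then show ?thesis
    using ne by (simp add: induced_char_def Let_def card_subgroup_image[OF H] cong: if_cong flip: sum_distrib_left)
qed

text \<open>Translation by \<open>n\<close> multiplies the sum of \<mu> over
  \<open>N \<inter> H\<close> by \<open>\<mu> n \<noteq> 1\<close>, so this sum is 0; with it vanish
  all coset sums of the extended \<mu>.\<close>

lemma coset_sum_induced_nontrivial:
  assumes n: "n \<in> N \<inter> H" "\<mu> n \<noteq> 1" and A: "A \<in> carrier (G Mod N)"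
  shows "(\<Sum>a\<in>A. induced_char G H \<mu> a) = 0"
proof -
  interpret Q: group "G Mod N" by (rule factorgroup_is_group)
  have HG: "H \<subseteq> carrier G" using H by (rule subgroup.subset)
  interpret NH: subgroup "N \<inter> H" G using subgroups_Inter_pair[OF subgroup_axioms H] .
  have "bij_betw (\<lambda>k. n \<otimes> k) (N \<inter> H) (N \<inter> H)"
    using n(1) NH.mem_carrier NH.m_closed NH.m_inv_closed
    by (intro bij_betw_byWitness[where f' = "\<lambda>k. inv n \<otimes> k"]) (auto simp flip: m_assoc)
  then have "(\<Sum>k\<in>N \<inter> H. \<mu> k) = (\<Sum>k\<in>N \<inter> H. \<mu> (n \<otimes> k))"
    by (rule sum.reindex_bij_betw[symmetric])
  also have "\<dots> = \<mu> n * (\<Sum>k\<in>N \<inter> H. \<mu> k)"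
    using n(1) by (simp add: linear_character_mult sum_distrib_left)
  finally have z: "(\<Sum>k\<in>N \<inter> H. \<mu> k) = 0" using n(2) by simp
  have zero: "(\<Sum>b\<in>B. zero_ext H \<mu> b) = 0" if B: "B \<in> carrier (G Mod N)" for B
  proof (cases "B \<in> (\<lambda>h. N #> h) ` H")
    case True
    then obtain h where h: "h \<in> H" "B = N #> h" by auto
    then show ?thesis by (simp add: coset_sum_zero_ext[OF H h(1) linear_character_mult] z)
  qed (simp add: coset_sum_zero_ext_disjoint[OF HG B])
  have "(\<Sum>X\<in>carrier (G Mod N).
      \<Sum>b\<in>inv\<^bsub>G Mod N\<^esub> X \<otimes>\<^bsub>G Mod N\<^esub> A \<otimes>\<^bsub>G Mod N\<^esub> X. zero_ext H \<mu> b) = 0"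
    by (rule sum.neutral, rule ballI, rule zero) (intro Q.m_closed Q.inv_closed A)
  then show ?thesis
    unfolding coset_sum_induced_char[OF HG A] by simp
qed

end

end

section \<open>Passage to the quotient\<close>

context finite_normal
begin

lemma quotient_char_apply:
  assumes \<chi>: "\<chi> \<in> Irr G" "N \<subseteq> char_kernel G \<chi>" and g: "g \<in> carrier G"
  shows "quotient_char G N \<chi> (N #> g) = \<chi> g"
proof -
  have "\<chi> ` (N #> g) = (\<lambda>n. \<chi> (n \<otimes> g)) ` N" by (auto simp: r_coset_def)
  also have "\<dots> = (\<lambda>n. \<chi> g) ` N"
    using Irr_coset_constant[OF \<chi>(1) normal_axioms finite_N \<chi>(2) _ g] by (intro image_cong) auto
  also have "\<dots> = {\<chi> g}" using card_N_neq_0 by (auto simp: image_constant_conv)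
  finally show ?thesis using g by (simp add: quotient_char_def carrier_FactGroup)
qed

text \<open>Serves as a left inverse of \<open>quotient_char\<close>, also on whole blocks. The
  restriction to the carrier reproduces the extensional original exactly.\<close>

definition inflation :: "('a set \<Rightarrow> complex) \<Rightarrow> 'a \<Rightarrow> complex" where
  "inflation f = (\<lambda>g\<in>carrier G. f (N #> g))"

lemma inflation_quotient_char:
  assumes "\<chi> \<in> Irr G" "N \<subseteq> char_kernel G \<chi>"
  shows "inflation (quotient_char G N \<chi>) = \<chi>"
proof
  fix g
  have "\<chi> g = undefined" if "g \<notin> carrier G"
    using assms(1) that by (auto simp: Irr_def character_of_def)
  then show "inflation (quotient_char G N \<chi>) g = \<chi> g"
    using quotient_char_apply[OF assms] by (simp add: inflation_def)
qed

lemma inflation_image_quotient_char: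
  assumes "X \<subseteq> Irr G" "\<forall>\<chi>\<in>X. N \<subseteq> char_kernel G \<chi>"
  shows "inflation ` quotient_char G N ` X = X"
proof -
  have "inflation (quotient_char G N \<chi>) = \<chi>" if "\<chi> \<in> X" for \<chi>
    using assms that by (intro inflation_quotient_char) auto
  then show ?thesis by (simp add: image_image cong: image_cong)
qed

lemma coset_sum_supercharacter:
  assumes X: "X \<subseteq> Irr G" and ker: "\<forall>\<chi>\<in>X. N \<subseteq> char_kernel G \<chi>" and A: "A \<in> carrier (G Mod N)"
  shows "(\<Sum>a\<in>A. supercharacter G X a) =
    of_nat (card N) * supercharacter (G Mod N) (quotient_char G N ` X) A"
proof -
  obtain g where g: "g \<in> carrier G" "A = N #> g" using A by (auto simp: carrier_FactGroup)
  have q: "quotient_char G N \<chi> (N #> h) = \<chi> h" if "\<chi> \<in> X" "h \<in> carrier G" for \<chi> h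
    using that X ker by (intro quotient_char_apply) auto
  have inj: "inj_on (quotient_char G N) X"
    by (rule inj_on_inverseI[where g = inflation]) (use X ker in \<open>auto intro!: inflation_quotient_char\<close>)
  have const: "supercharacter G X (n \<otimes> g) = supercharacter G X g" if n: "n \<in> N" for n
    unfolding supercharacter_def
    using X ker Irr_coset_constant[OF _ normal_axioms finite_N _ n g(1)] by (intro sum.cong) auto
  have "(\<Sum>a\<in>A. supercharacter G X a) = of_nat (card N) * supercharacter G X g"
    unfolding g(2) sum_r_coset[OF subset g(1)] by (simp add: const)
  moreover have "supercharacter (G Mod N) (quotient_char G N ` X) A = supercharacter G X g"
  proof -
    \<comment> \<open>The identity of the quotient is \<open>N\<close>, the coset of \<one>, so
      degrees are preserved and the weights in the two supercharacters agree.\<close>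
    have "quotient_char G N \<chi> N = \<chi> \<one>" if "\<chi> \<in> X" for \<chi>
      using q[OF that one_closed] subset by simp
    then show ?thesis
      using g by (simp add: supercharacter_def sum.reindex[OF inj] q cong: sum.cong)
  qed
  ultimately show ?thesis by simp
qed

lemma coset_sum_supercharacter_0:
  assumes X: "X \<subseteq> Irr G" and ker: "\<forall>\<chi>\<in>X. \<not> N \<subseteq> char_kernel G \<chi>" and A: "A \<in> carrier (G Mod N)"
  shows "(\<Sum>a\<in>A. supercharacter G X a) = 0"
proof -
  obtain g where g: "g \<in> carrier G" "A = N #> g" using A by (auto simp: carrier_FactGroup)
  have "(\<Sum>a\<in>A. \<chi> a) = 0" if "\<chi> \<in> X" for \<chi>
    unfolding g(2) using that X ker g(1) by (intro Irr_coset_sum_0[OF _ normal_axioms]) auto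
  then show ?thesis
    unfolding supercharacter_def by (subst sum.swap) (simp flip: sum_distrib_left)
qed

text \<open>Summands whose linear character is nontrivial on \<open>N \<inter> H i\<close>
  contribute nothing to the coset sums; each of the others descends to an induced linear character
  of the quotient.\<close>

lemma descend_monomial_sum:
  assumes lin: "\<forall>i\<in>{1..t}. subgroup (H i) G \<and> \<mu> i \<in> linear_characters (G\<lparr>carrier := H i\<rparr>)"
  obtains t' :: nat and H' \<mu>' where
    "\<forall>i\<in>{1..t'}. subgroup (H' i) (G Mod N) \<and> \<mu>' i \<in> linear_characters ((G Mod N)\<lparr>carrier := H' i\<rparr>)"
    "\<forall>A\<in>carrier (G Mod N). (\<Sum>a\<in>A. \<Sum>i\<in>{1..t::nat}. induced_char G (H i) (\<mu> i) a) =
       of_nat (card N) * (\<Sum>i\<in>{1..t'}. induced_char (G Mod N) (H' i) (\<mu>' i) A)"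
proof -
  define I where "I = {i \<in> {1..t}. \<forall>n\<in>N \<inter> H i. \<mu> i n = 1}"
  have "finite I" by (simp add: I_def)
  \<comment> \<open>The surviving indices are renumbered as an initial segment starting at 1, the
    form that \<open>almost_monomial\<close> requires.\<close>
  then obtain p where p: "bij_betw p {1..card I} I" using ex_bij_betw_nat_finite_1 by blast
  let ?H = "\<lambda>i. (\<lambda>h. N #> h) ` H i" and ?\<mu> = "\<lambda>i. coset_char (H i) (\<mu> i)"
  have I: "subgroup (H i) G" "\<mu> i \<in> linear_characters (G\<lparr>carrier := H i\<rparr>)" "\<forall>n\<in>N \<inter> H i. \<mu> i n = 1"
    if "i \<in> I" for i
    using that lin by (auto simp: I_def)
  show ?thesis
  proof
    show "\<forall>j\<in>{1..card I}. subgroup (?H (p j)) (G Mod N) \<and>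
        ?\<mu> (p j) \<in> linear_characters ((G Mod N)\<lparr>carrier := ?H (p j)\<rparr>)"
    proof
      fix j assume "j \<in> {1..card I}"
      then have "p j \<in> I" using p bij_betwE by blast
      then show "subgroup (?H (p j)) (G Mod N) \<and> ?\<mu> (p j) \<in> linear_characters ((G Mod N)\<lparr>carrier := ?H (p j)\<rparr>)"
        using coset_char_linear[OF I] by blast
    qed
  next
    show "\<forall>A\<in>carrier (G Mod N). (\<Sum>a\<in>A. \<Sum>i\<in>{1..t}. induced_char G (H i) (\<mu> i) a) =
       of_nat (card N) * (\<Sum>j\<in>{1..card I}. induced_char (G Mod N) (?H (p j)) (?\<mu> (p j)) A)"
    proof
      fix A assume A: "A \<in> carrier (G Mod N)"
      have "(\<Sum>a\<in>A. \<Sum>i\<in>{1..t}. induced_char G (H i) (\<mu> i) a) = (\<Sum>i\<in>{1..t}. \<Sum>a\<in>A. induced_char G (H i) (\<mu> i) a)"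
        by (rule sum.swap)
      also have "\<dots> = (\<Sum>i\<in>I. \<Sum>a\<in>A. induced_char G (H i) (\<mu> i) a)"
      proof (rule sum.mono_neutral_right)
        show "\<forall>i\<in>{1..t} - I. (\<Sum>a\<in>A. induced_char G (H i) (\<mu> i) a) = 0"
        proof
          fix i assume i: "i \<in> {1..t} - I"
          then obtain n where "n \<in> N \<inter> H i" "\<mu> i n \<noteq> 1" by (auto simp: I_def)
          then show "(\<Sum>a\<in>A. induced_char G (H i) (\<mu> i) a) = 0"
            using coset_sum_induced_nontrivial[of "H i" "\<mu> i" n A] lin i A by blast
        qed
      qed (auto simp: I_def)
      also have "\<dots> = (\<Sum>i\<in>I. of_nat (card N) * induced_char (G Mod N) (?H i) (?\<mu> i) A)"
        by (intro sum.cong refl coset_sum_induced_trivial I A)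
      also have "\<dots> = of_nat (card N) * (\<Sum>j\<in>{1..card I}. induced_char (G Mod N) (?H (p j)) (?\<mu> (p j)) A)"
        by (simp add: sum.reindex_bij_betw[OF p, symmetric] flip: sum_distrib_left)
      finally show "(\<Sum>a\<in>A. \<Sum>i\<in>{1..t}. induced_char G (H i) (\<mu> i) a) =
         of_nat (card N) * (\<Sum>j\<in>{1..card I}. induced_char (G Mod N) (?H (p j)) (?\<mu> (p j)) A)" .
    qed
  qed
qed

end

theorem theorem2p13:
  fixes G :: "('a, 'b) monoid_scheme" and C :: "'a sct" and N :: "'a set"
  assumes "group G" and "finite (carrier G)"
    and "supercharacter_theory G C"
    and "N \<lhd> G" and "C_normal G C N"
    and "almost_monomial G C"
  shows "almost_monomial (G Mod N) (quotient_sct G N C)"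
proof -
  interpret finite_normal N G
    using assms(2,4) by (simp add: finite_normal_def finite_normal_axioms_def)
  obtain \<X> \<K> where C: "C = (\<X>, \<K>)" by (cases C)
  note sct = assms(3)[unfolded C] and C_norm = assms(5)[unfolded C] and mon = assms(6)[unfolded C]
  have part: "partition_on (Irr G) \<X>" using sct unfolding supercharacter_theory_def prod.case by blast
  have fX: "finite \<X>" using finite_elements[OF finite_Irr[OF finite_carrier] part] .
  have Xsub: "X \<subseteq> Irr G" if "X \<in> \<X>" for X using that part by (auto simp: partition_on_def)
  \<comment> \<open>The good blocks are those that yield blocks of the quotient theory.\<close>
  define good where "good X \<longleftrightarrow> (\<forall>\<chi>\<in>X. N \<subseteq> char_kernel G \<chi>)" for X
  \<comment> \<open>This is where \<open>C\<close>-normality enters: a block that is not good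
    contains no character at all with \<open>N\<close> in its kernel, so its supercharacter has
    vanishing coset sums.\<close>
  have bad: "\<forall>\<chi>\<in>X. \<not> N \<subseteq> char_kernel G \<chi>" if "X \<in> \<X>" "\<not> good X" for X
    using that C_normal_kernel_block[OF finite_carrier sct C_norm that(1)] unfolding good_def by blast
  let ?q = "\<lambda>X. quotient_char G N ` X"
  have infl: "inflation ` ?q X = X" if "X \<in> \<X>" "good X" for X
    using inflation_image_quotient_char[OF Xsub[OF that(1)]] that(2) unfolding good_def by blast
  have inj: "inj_on ?q {X \<in> \<X>. good X}"
    by (rule inj_on_inverseI[where g = "\<lambda>W. inflation ` W"]) (use infl in blast)
  have separate: "\<exists>t H \<mu> \<alpha>. (\<forall>i\<in>{1..t::nat}. subgroup (H i) (G Mod N) \<and>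
          \<mu> i \<in> linear_characters ((G Mod N)\<lparr>carrier := H i\<rparr>)) \<and>
        (\<forall>A\<in>carrier (G Mod N). (\<Sum>i\<in>{1..t}. induced_char (G Mod N) (H i) (\<mu> i) A) =
          (\<Sum>W\<in>{?q X | X. X \<in> \<X> \<and> good X}. of_nat (\<alpha> W) * supercharacter (G Mod N) W A)) \<and>
        \<alpha> (?q Y) > (0::nat) \<and> \<alpha> (?q Z) = 0"
    if Y: "Y \<in> \<X>" "good Y" and Z: "Z \<in> \<X>" "good Z" and YZ: "?q Y \<noteq> ?q Z" for Y Z
  proof -
    have "Y \<noteq> Z" using YZ by blast
    note ex = mon[unfolded almost_monomial_def prod.case, THEN bspec, OF Y(1), THEN bspec, OF Z(1), THEN mp, OF this]
    obtain t H \<mu> \<alpha> where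
      lin: "\<forall>i\<in>{1..t::nat}. subgroup (H i) G \<and> \<mu> i \<in> linear_characters (G\<lparr>carrier := H i\<rparr>)" and
      eq: "\<forall>g\<in>carrier G. (\<Sum>i\<in>{1..t}. induced_char G (H i) (\<mu> i) g) =
        (\<Sum>X\<in>\<X>. of_nat (\<alpha> X) * supercharacter G X g)" and
      \<alpha>: "\<alpha> Y > (0::nat)" "\<alpha> Z = 0"
      using ex by (elim exE conjE) (rule that)
    obtain t' :: nat and H' \<mu>' where
      lin': "\<forall>i\<in>{1..t'}. subgroup (H' i) (G Mod N) \<and> \<mu>' i \<in> linear_characters ((G Mod N)\<lparr>carrier := H' i\<rparr>)" and
      ind': "\<forall>A\<in>carrier (G Mod N). (\<Sum>a\<in>A. \<Sum>i\<in>{1..t}. induced_char G (H i) (\<mu> i) a) =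
       of_nat (card N) * (\<Sum>i\<in>{1..t'}. induced_char (G Mod N) (H' i) (\<mu>' i) A)"
      by (rule descend_monomial_sum[OF lin]) (rule that)
    \<comment> \<open>Inflation recovers the block of \<open>G\<close> from its image, so
      coefficients are carried over unchanged; positivity at \<open>Y\<close> and vanishing at
      \<open>Z\<close> survive because both blocks are good.\<close>
    define \<alpha>' where "\<alpha>' W = \<alpha> (inflation ` W)" for W
    have eq': "(\<Sum>i\<in>{1..t'}. induced_char (G Mod N) (H' i) (\<mu>' i) A) =
          (\<Sum>W\<in>{?q X | X. X \<in> \<X> \<and> good X}. of_nat (\<alpha>' W) * supercharacter (G Mod N) W A)"
      if A: "A \<in> carrier (G Mod N)" for A
    proof -
      have Asub: "A \<subseteq> carrier G" using A r_coset_subset_G[OF subset] by (auto simp: carrier_FactGroup)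
      have "of_nat (card N) * (\<Sum>i\<in>{1..t'}. induced_char (G Mod N) (H' i) (\<mu>' i) A) =
          (\<Sum>a\<in>A. \<Sum>X\<in>\<X>. of_nat (\<alpha> X) * supercharacter G X a)"
        unfolding ind'[rule_format, OF A, symmetric] using eq Asub by (intro sum.cong) auto
      also have "\<dots> = (\<Sum>X\<in>\<X>. of_nat (\<alpha> X) * (\<Sum>a\<in>A. supercharacter G X a))"
        by (subst sum.swap) (simp add: sum_distrib_left)
      \<comment> \<open>The blocks that are not good drop out.\<close>
      also have "\<dots> = (\<Sum>X\<in>{X \<in> \<X>. good X}. of_nat (\<alpha> X) * (\<Sum>a\<in>A. supercharacter G X a))"
        using fX coset_sum_supercharacter_0[OF Xsub bad A] by (intro sum.mono_neutral_right) auto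
      also have "\<dots> = (\<Sum>X\<in>{X \<in> \<X>. good X}. of_nat (card N) * (of_nat (\<alpha>' (?q X)) * supercharacter (G Mod N) (?q X) A))"
      proof (rule sum.cong[OF refl])
        fix X assume "X \<in> {X \<in> \<X>. good X}"
        then have X: "X \<in> \<X>" "good X" by auto
        then show "of_nat (\<alpha> X) * (\<Sum>a\<in>A. supercharacter G X a) =
            of_nat (card N) * (of_nat (\<alpha>' (?q X)) * supercharacter (G Mod N) (?q X) A)"
          using coset_sum_supercharacter[OF Xsub[OF X(1)] _ A] unfolding good_def \<alpha>'_def infl[OF X] by simp
      qed
      also have "\<dots> = of_nat (card N) * (\<Sum>W\<in>?q ` {X \<in> \<X>. good X}. of_nat (\<alpha>' W) * supercharacter (G Mod N) W A)"
        unfolding sum_distrib_left by (rule sum.reindex_cong[OF inj refl refl, symmetric])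
      also have "?q ` {X \<in> \<X>. good X} = {?q X | X. X \<in> \<X> \<and> good X}" by blast
      \<comment> \<open>Both sides carry the same factor |N|, which is cancelled.\<close>
      finally show ?thesis using card_N_neq_0 by simp
    qed
    have \<alpha>': "\<alpha>' (?q Y) > 0" "\<alpha>' (?q Z) = 0"
      using \<alpha> by (simp_all add: \<alpha>'_def infl Y Z)
    show ?thesis
    proof (rule exI[of _ t'], rule exI[of _ H'], rule exI[of _ \<mu>'], rule exI[of _ \<alpha>'], intro conjI)
      show "\<forall>A\<in>carrier (G Mod N). (\<Sum>i\<in>{1..t'}. induced_char (G Mod N) (H' i) (\<mu>' i) A) =
          (\<Sum>W\<in>{?q X | X. X \<in> \<X> \<and> good X}. of_nat (\<alpha>' W) * supercharacter (G Mod N) W A)"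
        by (rule ballI) (rule eq')
    qed (fact lin' \<alpha>')+
  qed
  show ?thesis
    unfolding almost_monomial_def quotient_sct_def C prod.case good_def[symmetric]
  proof (intro ballI impI)
    fix V W assume "V \<in> {?q X | X. X \<in> \<X> \<and> good X}" "W \<in> {?q X | X. X \<in> \<X> \<and> good X}" "V \<noteq> W"
    then obtain Y Z where YZ: "V = ?q Y" "W = ?q Z" "Y \<in> \<X>" "good Y" "Z \<in> \<X>" "good Z" "?q Y \<noteq> ?q Z"
      by blast
    show "\<exists>t H \<mu> \<alpha>. (\<forall>i\<in>{1..t::nat}. subgroup (H i) (G Mod N) \<and>
          \<mu> i \<in> linear_characters ((G Mod N)\<lparr>carrier := H i\<rparr>)) \<and>
        (\<forall>A\<in>carrier (G Mod N). (\<Sum>i\<in>{1..t}. induced_char (G Mod N) (H i) (\<mu> i) A) =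
          (\<Sum>W\<in>{?q X | X. X \<in> \<X> \<and> good X}. of_nat (\<alpha> W) * supercharacter (G Mod N) W A)) \<and>
        \<alpha> V > (0::nat) \<and> \<alpha> W = 0"
      unfolding YZ(1,2) by (rule separate[OF YZ(3-7)])
  qed
qed

end
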